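(* Let $T>0$, $\alpha\in(\frac13,1]$ and $\mathbf Z\in\boldsymbol{\mathcal C}^\alpha_{g,T}(\mathbb R^K)$. Assume that $\mathbf Y=(Y,Y')\in\boldsymbol{\mathcal D}_{Z,T}(\mathbb R^K)$ and $\lambda\in C_T(\mathbb R)$ satisfy $$\int_0^T\lambda_t\,\dot\phi_t\,dt=\int_0^T\phi_tY_t\,d\mathbf Z_t$$ for all $\phi\in C^\infty_T(\mathbb R)$ such that $\phi_0=\phi_T=0$. Then for all $0\le s\le t\le T$, $$\lambda_t-\lambda_s=-\int_s^tY_r\,d\mathbf Z_r.$$
   Context: $C_T(E)$, $C^\alpha_T(E)$, $C^\infty_T(E)$ are the continuous, $\alpha$-Hölder and smooth paths $[0,T]\to E$; $\delta f_{st}=f_t-f_s$; $C^\beta_{2,T}(E)$ is the space of maps $\Xi$ on $\{0\le s\le t\le T\}$ with $\sup_{s<t}|\Xi_{st}|/|t-s|^\beta<\infty$. For $\alpha\in(\frac13,\frac12]$, $\boldsymbol{\mathcal C}^\alpha_{g,T}(\mathbb R^K)$ (geometric rough paths $\mathbf Z=(Z,\mathbb Z)$) is the closure of $\{(Z,\mathbb Z):Z\text{ Lipschitz},\ \mathbb Z^{lk}_{st}=\int_s^t\delta Z^l_{sr}\,dZ^k_r\}$ in the metric $[Z^{(1)}-Z^{(2)}]_\alpha+[\mathbb Z^{(1)}-\mathbb Z^{(2)}]_{2\alpha}$ (Hölder seminorms); for $\alpha\in(\frac12,1]$ it is $C^\alpha_T(\mathbb R^K)$ and $\mathbf Z=Z$.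 For $\alpha\in(\frac13,\frac12]$, $\boldsymbol{\mathcal D}_{Z,T}(E)$ is the space of $\mathbf Y=(Y,Y')\in C^\alpha_T(E)\oplus C^\alpha_T(E^K)$ with $\delta Y_{st}-\sum_kY'^k_s\delta Z^k_{st}\in C^{2\alpha}_{2,T}(E)$; for $\alpha\in(\frac12,1]$, $\boldsymbol{\mathcal D}_{Z,T}(E)=C^\alpha_T(E)$ and $\mathbf Y=Y$. For $(Y,Y')\in\boldsymbol{\mathcal D}_{Z,T}(\mathbb R^K)$, $\int_s^tY_r\,d\mathbf Z_r$ is the limit, as the mesh of partitions of $[s,t]$ tends to $0$, of $\sum_i\big(\sum_kY^k_{t_i}\delta Z^k_{t_it_{i+1}}+\sum_{k,l}Y'^{kl}_{t_i}\mathbb Z^{lk}_{t_it_{i+1}}\big)$ (Young integral, no $\mathbb Z$ term, if $\alpha>\frac12$). For smooth $\phi$, the integral $\int\phi Y\,d\mathbf Z$ is that of the controlled path $\phi\mathbf Y=(\phi Y,\phi Y')$. *)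

theory Defs
  imports "HOL-Analysis.Analysis"
begin

text \<open>Paths on \<open>[0,T]\<close> and maps on \<open>{0 \<le> s \<le> t \<le> T}\<close> are total functions whose values elsewhere
  are irrelevant.\<close>

definition incr :: "(real \<Rightarrow> 'e::real_normed_vector) \<Rightarrow> real \<Rightarrow> real \<Rightarrow> 'e" where
  "incr f s t = f t - f s"

definition holder_seminorm :: "real \<Rightarrow> real \<Rightarrow> (real \<Rightarrow> real \<Rightarrow> 'e::real_normed_vector) \<Rightarrow> ennreal" where
  "holder_seminorm T \<beta> \<Xi> =
     (SUP (s, t) \<in> {(s, t). 0 \<le> s \<and> s < t \<and> t \<le> T}. ennreal (norm (\<Xi> s t) / (t - s) powr \<beta>))"

definition holder_maps2 :: "real \<Rightarrow> real \<Rightarrow> (real \<Rightarrow> real \<Rightarrow> 'e::real_normed_vector) set" where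
  "holder_maps2 T \<beta> = {\<Xi>. holder_seminorm T \<beta> \<Xi> < \<infinity>}"

definition holder_paths :: "real \<Rightarrow> real \<Rightarrow> (real \<Rightarrow> 'e::real_normed_vector) set" where
  "holder_paths T \<alpha> = {f. holder_seminorm T \<alpha> (incr f) < \<infinity>}"

definition path_deriv :: "real \<Rightarrow> (real \<Rightarrow> 'e::real_normed_vector) \<Rightarrow> real \<Rightarrow> 'e" where
  "path_deriv T f t = vector_derivative f (at t within {0..T})"

text \<open>Smoothness up to the boundary, with one-sided derivatives at \<open>0\<close> and \<open>T\<close>.\<close>

definition smooth_paths :: "real \<Rightarrow> (real \<Rightarrow> 'e::real_normed_vector) set" where
  "smooth_paths T = {f. \<forall>n. (path_deriv T ^^ n) f differentiable_on {0..T}}"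

definition partitions :: "real \<Rightarrow> real \<Rightarrow> real list set" where
  "partitions s t = {p. p \<noteq> [] \<and> sorted_wrt (<) p \<and> hd p = s \<and> last p = t}"

text \<open>The inserted \<open>0\<close> only matters for the one-point partition of \<open>[s,s]\<close>.\<close>

definition mesh :: "real list \<Rightarrow> real" where
  "mesh p = Max (insert 0 ((\<lambda>i. p ! Suc i - p ! i) ` {..<length p - 1}))"

definition mesh_to_zero :: "real \<Rightarrow> real \<Rightarrow> real list filter" where
  "mesh_to_zero s t = inf (filtercomap mesh (nhds 0)) (principal (partitions s t))"

definition partition_integral :: "(real \<Rightarrow> real \<Rightarrow> real) \<Rightarrow> real \<Rightarrow> real \<Rightarrow> real" where
  "partition_integral \<Xi> s t =
     Lim (mesh_to_zero s t) (\<lambda>p. \<Sum>i<length p - 1. \<Xi> (p ! i) (p ! Suc i))"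

text \<open>The entry \<open>(l,k)\<close> is the Riemann--Stieltjes integral of \<open>Z\<^sup>l\<^sub>r - Z\<^sup>l\<^sub>s\<close> against \<open>Z\<^sup>k\<close>.\<close>

definition lipschitz_lift :: "(real \<Rightarrow> real^'k) \<Rightarrow> real \<Rightarrow> real \<Rightarrow> real^'k^'k" where
  "lipschitz_lift Z s t =
     (\<chi> l k. partition_integral (\<lambda>u v. incr Z s u $ l * incr Z u v $ k) s t)"

definition rough_path_dist ::
  "real \<Rightarrow> real \<Rightarrow> (real \<Rightarrow> real^'k) \<times> (real \<Rightarrow> real \<Rightarrow> real^'k^'k)
     \<Rightarrow> (real \<Rightarrow> real^'k) \<times> (real \<Rightarrow> real \<Rightarrow> real^'k^'k) \<Rightarrow> ennreal" where
  "rough_path_dist T \<alpha> = (\<lambda>(Z1, ZZ1) (Z2, ZZ2).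
     holder_seminorm T \<alpha> (incr (\<lambda>t. Z1 t - Z2 t)) +
     holder_seminorm T (2 * \<alpha>) (\<lambda>s t. ZZ1 s t - ZZ2 s t))"

text \<open>For \<open>\<alpha> > 1/2\<close> there is no second level; a path \<open>Z\<close> is then identified with \<open>(Z, 0)\<close>.
  For \<open>\<alpha> \<le> 1/2\<close> the closure lies in \<open>holder_paths T \<alpha> \<times> holder_maps2 T (2 * \<alpha>)\<close> automatically,
  since elements of the closure have finite distance from a Lipschitz lift.\<close>

definition geometric_rough_paths ::
  "real \<Rightarrow> real \<Rightarrow> ((real \<Rightarrow> real^'k) \<times> (real \<Rightarrow> real \<Rightarrow> real^'k^'k)) set" where
  "geometric_rough_paths T \<alpha> =
     (if \<alpha> \<le> 1/2
      then {\<Z>. \<forall>\<epsilon>>0. \<exists>W L. L-lipschitz_on {0..T} W \<and>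
                       rough_path_dist T \<alpha> \<Z> (W, lipschitz_lift W) < \<epsilon>}
      else {(Z, ZZ). Z \<in> holder_paths T \<alpha> \<and> ZZ = (\<lambda>_ _. 0)})"

text \<open>\<open>Y' s $ k\<close> is the coefficient, in \<open>E\<close>, of the increment of \<open>Z\<^sup>k\<close>. As above, \<open>Y\<close> is identified
  with \<open>(Y, 0)\<close> when \<open>\<alpha> > 1/2\<close>.\<close>

definition controlled_paths ::
  "real \<Rightarrow> real \<Rightarrow> (real \<Rightarrow> real^'k)
     \<Rightarrow> ((real \<Rightarrow> 'e::real_normed_vector) \<times> (real \<Rightarrow> 'e^'k)) set" where
  "controlled_paths T \<alpha> Z =
     (if \<alpha> \<le> 1/2
      then {(Y, Y'). Y \<in> holder_paths T \<alpha> \<and> Y' \<in> holder_paths T \<alpha> \<and>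
              (\<lambda>s t. incr Y s t - (\<Sum>k\<in>UNIV. incr Z s t $ k *\<^sub>R Y' s $ k)) \<in> holder_maps2 T (2 * \<alpha>)}
      else {(Y, Y'). Y \<in> holder_paths T \<alpha> \<and> Y' = (\<lambda>_. 0)})"

text \<open>Here \<open>E\<close> is \<open>real^'k\<close>, and \<open>Y'\<^sup>k\<^sup>l\<close>, the coefficient of \<open>Z\<^sup>l\<close> in \<open>Y\<^sup>k\<close>, is \<open>Y' u $ l $ k\<close>.
  When the second level is \<open>0\<close> this is the Young integral.\<close>

definition rough_integral ::
  "(real \<Rightarrow> real^'k) \<times> (real \<Rightarrow> real^'k^'k)
     \<Rightarrow> (real \<Rightarrow> real^'k) \<times> (real \<Rightarrow> real \<Rightarrow> real^'k^'k) \<Rightarrow> real \<Rightarrow> real \<Rightarrow> real" where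
  "rough_integral = (\<lambda>(Y, Y') (Z, ZZ).
     partition_integral (\<lambda>u v.
       (\<Sum>k\<in>UNIV. Y u $ k * incr Z u v $ k) +
       (\<Sum>k\<in>UNIV. \<Sum>l\<in>UNIV. Y' u $ l $ k * ZZ u v $ l $ k)))"

definition scale_controlled ::
  "(real \<Rightarrow> real) \<Rightarrow> (real \<Rightarrow> 'e::real_normed_vector) \<times> (real \<Rightarrow> 'e^'k)
     \<Rightarrow> (real \<Rightarrow> 'e) \<times> (real \<Rightarrow> 'e^'k)" where
  "scale_controlled \<phi> = (\<lambda>(Y, Y'). (\<lambda>t. \<phi> t *\<^sub>R Y t, \<lambda>t. \<phi> t *\<^sub>R Y' t))"

end

theory Submission
  imports Defs
begin

text \<open>The integrand of the rough integral is the germ \<open>\<Xi> u v = Y u \<bullet> incr Z u v + Y' u \<bullet> ZZ u v\<close>. By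
Chen's relation its failure to be additive is of order \<open>3 \<alpha>\<close>, or \<open>2 \<alpha>\<close> in the Young case, and this
exceeds 1 (\<open>rough_germ_bounds\<close>, \<open>Young_germ_bounds\<close>). The sewing lemma (\<open>sewing\<close>) therefore provides a continuous function
\<open>J\<close> on \<open>{0..T}\<close> whose increments agree with \<open>\<Xi>\<close> up to \<open>O((v - u) powr \<gamma>)\<close> for some
\<open>\<gamma> > 1\<close>, and the rough integral over \<open>{s..t}\<close> is \<open>J t - J s\<close>
(\<open>partition_integral_eqI_powr\<close>).

The germ of the controlled path multiplied by \<open>\<phi>\<close> is simply \<open>\<phi> u * \<Xi> u v\<close>. To the required order it
equals \<open>\<phi> u * (J v - J u)\<close>, so its integral is a Riemann--Stieltjes integral, which integration by
parts turns into minus the integral of \<open>J * \<phi>'\<close> when \<open>\<phi>\<close> vanishes at the ends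
(\<open>partition_integral_weighted_germ\<close>). The hypothesis now says that \<open>lam + J\<close> is orthogonal to \<open>\<phi>'\<close>
for all test functions \<open>\<phi>\<close>. Polynomials already suffice as test functions in the du Bois-Reymond lemma
(\<open>du_Bois_Reymond_polynomial\<close>): \<open>lam + J\<close> is constant, which is the assertion.

In the rough case the driving path enters only through Chen's relation and the Hoelder bounds of both levels
(\<open>geometric_rough_path_Chen\<close>, \<open>geometric_rough_path_bounds\<close>). Both are first proved for lifts of
Lipschitz paths, with the same sewing lemma, and then carried over by approximation.\<close>

section \<open>Sewing an almost additive germ\<close>

text \<open>The heart of the sewing lemma: a Riemann sum over finitely many points stays as close to the one-term
sum as the defect estimate allows, with a constant that depends on neither the number nor the position
of the points. Bisection of the interval replaces the usual successive removal of points, and the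
condition \<open>\<gamma> > 1\<close> makes the contributions of the generations of the bisection a convergent
geometric series.\<close>

lemma chain_sum_bound:
  fixes \<Xi> :: "real \<Rightarrow> real \<Rightarrow> real" and x :: "nat \<Rightarrow> real" and \<gamma> :: real
  defines "K \<equiv> 2 / (1 - 2 powr (1 - \<gamma>))"
  assumes "\<gamma> > 1" and "C \<ge> 0"
    and defect: "\<And>s u t. \<lbrakk>a \<le> s; s \<le> u; u \<le> t; t \<le> b\<rbrakk>
                   \<Longrightarrow> \<bar>\<Xi> s t - \<Xi> s u - \<Xi> u t\<bar> \<le> C * (t - s) powr \<gamma>"
    and x: "\<And>i j. \<lbrakk>i \<le> j; j \<le> N\<rbrakk> \<Longrightarrow> x i \<le> x j" "a \<le> x 0" "x N \<le> b"
    and "m \<le> n" "n \<le> N"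
  shows "\<bar>(\<Sum>i=m..<n. \<Xi> (x i) (x (Suc i))) - \<Xi> (x m) (x n)\<bar> \<le> K * C * (x n - x m) powr \<gamma>"
  using \<open>m \<le> n\<close> \<open>n \<le> N\<close>
proof (induction "n - m" arbitrary: m n rule: less_induct)
  case less
  have "2 powr (1 - \<gamma>) < 2 powr 0"
    using \<open>\<gamma> > 1\<close> by (intro powr_less_mono; auto)
  then have c: "2 powr (1 - \<gamma>) < 1" by simp
  then have Kpos: "K > 0" by (simp add: K_def)
  \<comment> \<open>This fixed-point equation, solvable because \<open>\<gamma> > 1\<close>, is what the choice of \<open>K\<close> is for: each of
    the two halves contributes \<open>K * (h / 2) powr \<gamma>\<close> and reinserting the two split points costs 2
    defects.\<close>
  have Keq: "K * 2 powr (1 - \<gamma>) + 2 = K"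
    unfolding K_def using c by (auto simp: divide_simps)
  have range: "a \<le> x i \<and> x i \<le> b" if "i \<le> N" for i
    using x(1)[of 0 i] x(1)[of i N] x(2,3) that by auto
  have diag: "\<Xi> s s = 0" if "a \<le> s" "s \<le> b" for s
    using defect[of s s s] that by simp
  show ?case
  proof (cases "m = n")
    case True
    then show ?thesis using diag[of "x m"] range[of m] less.prems by simp
  next
    case False
    define h where "h = x n - x m"
    have "h \<ge> 0" using x(1)[of m n] less.prems by (simp add: h_def)
    define A where "A = {j \<in> {m..<n}. x j \<le> (x m + x n) / 2}"
    have "finite A" "m \<in> A"
      using False less.prems \<open>h \<ge> 0\<close> by (auto simp: A_def h_def)
    define j where "j = Max A"
    have "j \<in> A" using \<open>finite A\<close> \<open>m \<in> A\<close> Max_in j_def by blast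
    then have j: "m \<le> j" "j < n" "x j \<le> (x m + x n) / 2" by (auto simp: A_def)
    have j': "x (Suc j) \<ge> (x m + x n) / 2"
    proof (cases "Suc j = n")
      case True
      then show ?thesis using \<open>h \<ge> 0\<close> by (simp add: h_def)
    next
      case False
      have "Suc j \<notin> A" using Max_ge[OF \<open>finite A\<close>] j_def by fastforce
      then show ?thesis using j False by (auto simp: A_def)
    qed
    \<comment> \<open>The interval between consecutive points that straddles the midpoint is left as it is; what
      remains on either side of it is at most half as long and has fewer points.\<close>
    have half: "K * C * d powr \<gamma> \<le> K * C * (h / 2) powr \<gamma>" if "0 \<le> d" "d \<le> h / 2" for d
      using that \<open>\<gamma> > 1\<close> Kpos \<open>C \<ge> 0\<close> by (intro mult_left_mono powr_mono2; auto)
    have full: "C * d powr \<gamma> \<le> C * h powr \<gamma>" if "0 \<le> d" "d \<le> h" for d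
      using that \<open>\<gamma> > 1\<close> \<open>C \<ge> 0\<close> by (intro mult_left_mono powr_mono2; auto)
    let ?S = "\<lambda>m n. \<Sum>i=m..<n. \<Xi> (x i) (x (Suc i))"
    have split: "?S m n = ?S m j + \<Xi> (x j) (x (Suc j)) + ?S (Suc j) n"
      using j sum.atLeastLessThan_concat[of m j n "\<lambda>i. \<Xi> (x i) (x (Suc i))"]
        sum.atLeast_Suc_lessThan[of j n "\<lambda>i. \<Xi> (x i) (x (Suc i))"] by simp
    have l: "x m \<le> x j" "x j \<le> x (Suc j)" "x (Suc j) \<le> x n" "x j \<le> x n"
      using x(1) j less.prems by auto
    have r: "a \<le> x m" "a \<le> x j" "a \<le> x (Suc j)" "x n \<le> b" "x (Suc j) \<le> b"
      using range j less.prems by auto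
    have "\<bar>?S m j - \<Xi> (x m) (x j)\<bar> \<le> K * C * (x j - x m) powr \<gamma>"
      using less.hyps[of j m] j less.prems by auto
    also have "\<dots> \<le> K * C * (h / 2) powr \<gamma>"
      using j l by (intro half; auto simp: h_def field_simps)
    finally have 1: "\<bar>?S m j - \<Xi> (x m) (x j)\<bar> \<le> K * C * (h / 2) powr \<gamma>" .
    have "\<bar>?S (Suc j) n - \<Xi> (x (Suc j)) (x n)\<bar> \<le> K * C * (x n - x (Suc j)) powr \<gamma>"
      using less.hyps[of n "Suc j"] j less.prems by auto
    also have "\<dots> \<le> K * C * (h / 2) powr \<gamma>"
      using j' l by (intro half; auto simp: h_def field_simps)
    finally have 2: "\<bar>?S (Suc j) n - \<Xi> (x (Suc j)) (x n)\<bar> \<le> K * C * (h / 2) powr \<gamma>" .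
    have 3: "\<bar>\<Xi> (x m) (x n) - \<Xi> (x m) (x j) - \<Xi> (x j) (x n)\<bar> \<le> C * h powr \<gamma>"
      using defect[of "x m" "x j" "x n"] l r by (auto simp: h_def)
    have "\<bar>\<Xi> (x j) (x n) - \<Xi> (x j) (x (Suc j)) - \<Xi> (x (Suc j)) (x n)\<bar> \<le> C * (x n - x j) powr \<gamma>"
      using defect[of "x j" "x (Suc j)" "x n"] l r by auto
    also have "\<dots> \<le> C * h powr \<gamma>" using l by (intro full; auto simp: h_def)
    finally have 4: "\<bar>\<Xi> (x j) (x n) - \<Xi> (x j) (x (Suc j)) - \<Xi> (x (Suc j)) (x n)\<bar> \<le> C * h powr \<gamma>" .
    have triangle: "\<bar>p + q + r - e\<bar> \<le> 2 * A + 2 * B"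
      if "\<bar>p - p'\<bar> \<le> A" "\<bar>r - r'\<bar> \<le> A" "\<bar>e - p' - f\<bar> \<le> B" "\<bar>f - q - r'\<bar> \<le> B"
      for p p' q r r' e f A B :: real
      using that unfolding abs_le_iff by linarith
    have "\<bar>?S m n - \<Xi> (x m) (x n)\<bar> \<le> 2 * (K * C * (h / 2) powr \<gamma>) + 2 * (C * h powr \<gamma>)"
      unfolding split by (rule triangle[OF 1 2 3 4])
    also have "(h / 2) powr \<gamma> = h powr \<gamma> * 2 powr (1 - \<gamma>) / 2"
      using \<open>h \<ge> 0\<close> by (simp add: powr_divide powr_diff)
    also have "2 * (K * C * (h powr \<gamma> * 2 powr (1 - \<gamma>) / 2)) + 2 * (C * h powr \<gamma>)
                 = (K * 2 powr (1 - \<gamma>) + 2) * (C * h powr \<gamma>)"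
      by (simp add: algebra_simps)
    finally show ?thesis by (simp add: Keq h_def mult.assoc)
  qed
qed

text \<open>On a finite set the Riemann sums along the set itself are an exactly additive function, and
\<open>chain_sum_bound\<close> compares its increment between any two points of the set with \<open>\<Xi>\<close>.\<close>

lemma finite_sewing:
  fixes \<Xi> :: "real \<Rightarrow> real \<Rightarrow> real"
  assumes "\<gamma> > 1" and "C \<ge> 0"
    and defect: "\<And>s u t. \<lbrakk>a \<le> s; s \<le> u; u \<le> t; t \<le> b\<rbrakk>
                   \<Longrightarrow> \<bar>\<Xi> s t - \<Xi> s u - \<Xi> u t\<bar> \<le> C * (t - s) powr \<gamma>"
    and "finite F" "F \<subseteq> {a..b}"
  shows "\<exists>J. \<forall>u\<in>F. \<forall>v\<in>F. u \<le> v \<longrightarrow>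
           \<bar>J v - J u - \<Xi> u v\<bar> \<le> 2 / (1 - 2 powr (1 - \<gamma>)) * C * (v - u) powr \<gamma>"
proof -
  define xs where "xs = sorted_list_of_set F"
  have xs: "sorted_wrt (<) xs" "set xs = F"
    using \<open>finite F\<close> by (auto simp: xs_def)
  define N where "N = length xs - 1"
  define idx where "idx = the_inv_into {..<length xs} ((!) xs)"
  have "inj_on ((!) xs) {..<length xs}"
    using xs(1) by (simp add: inj_on_nth xs_def)
  then have idx: "idx u < length xs" "xs ! idx u = u" if "u \<in> F" for u
    using the_inv_into_into[of "(!) xs" "{..<length xs}" u "{..<length xs}"]
      f_the_inv_into_f[of "(!) xs" "{..<length xs}" u] that xs(2)
    by (auto simp: idx_def image_def set_conv_nth)
  have mono: "xs ! i \<le> xs ! j" if "i \<le> j" "j < length xs" for i j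
    using xs(1) that by (cases "i = j"; auto simp: sorted_wrt_iff_nth_less less_imp_le)
  define J where "J = (\<lambda>u. \<Sum>i=0..<idx u. \<Xi> (xs ! i) (xs ! Suc i))"
  have "\<bar>J v - J u - \<Xi> u v\<bar> \<le> 2 / (1 - 2 powr (1 - \<gamma>)) * C * (v - u) powr \<gamma>"
    if uv: "u \<in> F" "v \<in> F" "u \<le> v" for u v
  proof -
    have "xs \<noteq> []" using uv xs(2) by auto
    have "idx u \<le> idx v"
    proof (rule ccontr)
      assume "\<not> idx u \<le> idx v"
      then have "xs ! idx v < xs ! idx u"
        using xs(1) idx(1)[OF uv(1)] by (simp add: sorted_wrt_iff_nth_less)
      then show False using idx uv by auto
    qed
    have "J v - J u = (\<Sum>i=idx u..<idx v. \<Xi> (xs ! i) (xs ! Suc i))"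
      unfolding J_def using \<open>idx u \<le> idx v\<close>
      using sum.atLeastLessThan_concat[of 0 "idx u" "idx v" "\<lambda>i. \<Xi> (xs ! i) (xs ! Suc i)"] by simp
    moreover have "xs ! 0 \<in> F" "xs ! N \<in> F"
      using \<open>xs \<noteq> []\<close> xs(2) by (auto simp: N_def)
    then have "a \<le> xs ! 0" "xs ! N \<le> b" using \<open>F \<subseteq> {a..b}\<close> by auto
    then have "\<bar>(\<Sum>i=idx u..<idx v. \<Xi> (xs ! i) (xs ! Suc i)) - \<Xi> (xs ! idx u) (xs ! idx v)\<bar>
        \<le> 2 / (1 - 2 powr (1 - \<gamma>)) * C * (xs ! idx v - xs ! idx u) powr \<gamma>"
      using idx(1)[OF uv(2)] \<open>idx u \<le> idx v\<close> mono
      by (intro chain_sum_bound[OF assms(1,2) defect, where N = N]; auto simp: N_def)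
    ultimately show ?thesis using idx(2) uv by simp
  qed
  then show ?thesis by blast
qed

text \<open>The constant in \<open>finite_sewing\<close> does not depend on the finite set, so the finite solutions extend to
the whole interval by compactness: the functions confined to a product of compact intervals form a compact
set (Tychonoff), each condition on \<open>J\<close> is closed, and finitely many conditions involve finitely many points.
Convergence of the Riemann sums then becomes a consequence of the existence of \<open>J\<close>.\<close>

lemma sewing_closed:
  fixes \<Xi> :: "real \<Rightarrow> real \<Rightarrow> real"
  assumes "\<gamma> > 1" and "C \<ge> 0"
    and defect: "\<And>s u t. \<lbrakk>a \<le> s; s \<le> u; u \<le> t; t \<le> b\<rbrakk>
                   \<Longrightarrow> \<bar>\<Xi> s t - \<Xi> s u - \<Xi> u t\<bar> \<le> C * (t - s) powr \<gamma>"
  obtains J where "\<And>u v. \<lbrakk>a \<le> u; u \<le> v; v \<le> b\<rbrakk>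
      \<Longrightarrow> \<bar>J v - J u - \<Xi> u v\<bar> \<le> 2 / (1 - 2 powr (1 - \<gamma>)) * C * (v - u) powr \<gamma>"
proof -
  define \<kappa> where "\<kappa> = 2 / (1 - 2 powr (1 - \<gamma>)) * C"
  \<comment> \<open>\<open>J a = 0\<close> can be imposed, and then the estimate between \<open>a\<close> and \<open>t\<close> confines \<open>J t\<close> to a compact
    interval.\<close>
  define B where "B = (\<lambda>t. \<bar>\<Xi> a t\<bar> + \<bar>\<kappa> * (t - a) powr \<gamma>\<bar>)"
  define I where "I = {(u, v). a \<le> u \<and> u \<le> v \<and> v \<le> b}"
  define f :: "real \<times> real \<Rightarrow> (real \<Rightarrow> real) set"
    where "f = (\<lambda>(u, v). {J. \<bar>J v - J u - \<Xi> u v\<bar> \<le> \<kappa> * (v - u) powr \<gamma>})"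
  have "compactin (product_topology (\<lambda>i. euclidean) UNIV) (Pi\<^sub>E UNIV (\<lambda>t. {- B t..B t}))"
    by (subst compactin_PiE; auto)
  then have comp: "compact (Pi\<^sub>E UNIV (\<lambda>t. {- B t..B t}))"
    by (simp add: euclidean_product_topology)
  have closed: "closed (f p)" for p
    unfolding f_def by (cases p; auto intro!: closed_Collect_le continuous_intros)
  have fip: "Pi\<^sub>E UNIV (\<lambda>t. {- B t..B t}) \<inter> (\<Inter>p\<in>I'. f p) \<noteq> {}" if "finite I'" "I' \<subseteq> I" for I'
  proof -
    define F where "F = {a..b} \<inter> insert a (fst ` I' \<union> snd ` I')"
    have "\<exists>J. \<forall>u\<in>F. \<forall>v\<in>F. u \<le> v \<longrightarrow> \<bar>J v - J u - \<Xi> u v\<bar> \<le> \<kappa> * (v - u) powr \<gamma>"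
      unfolding \<kappa>_def
      by (rule finite_sewing[OF assms(1,2) defect]; (use that in \<open>auto simp: F_def\<close>))
    then obtain J where J: "\<And>u v. \<lbrakk>u \<in> F; v \<in> F; u \<le> v\<rbrakk> \<Longrightarrow> \<bar>J v - J u - \<Xi> u v\<bar> \<le> \<kappa> * (v - u) powr \<gamma>"
      by metis
    define J' where "J' = (\<lambda>t. if t \<in> F then J t - J a else 0)"
    have "J' t \<in> {- B t..B t}" for t
    proof (cases "t \<in> F")
      case True
      then have "a \<in> F" "a \<le> t" by (auto simp: F_def)
      then show ?thesis using J[of a t] True by (auto simp: J'_def B_def)
    qed (auto simp: J'_def B_def)
    moreover have "J' \<in> f p" if "p \<in> I'" for p
    proof (cases p)
      case (Pair u v)
      have "u \<in> fst ` I'" "v \<in> snd ` I'"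
        using imageI[OF that, of fst] imageI[OF that, of snd] Pair by simp_all
      moreover have "a \<le> u" "u \<le> v" "v \<le> b"
        using that \<open>I' \<subseteq> I\<close> Pair by (auto simp: I_def)
      ultimately have "u \<in> F" "v \<in> F" "u \<le> v" by (auto simp: F_def)
      then show ?thesis using J[of u v] Pair by (simp add: f_def J'_def)
    qed
    ultimately have "J' \<in> Pi\<^sub>E UNIV (\<lambda>t. {- B t..B t}) \<inter> (\<Inter>p\<in>I'. f p)"
      unfolding PiE_UNIV_domain by (intro IntI INT_I Pi_I)
    then show ?thesis by (metis empty_iff)
  qed
  have ne: "Pi\<^sub>E UNIV (\<lambda>t. {- B t..B t}) \<inter> (\<Inter>p\<in>I. f p) \<noteq> {}"
    by (rule compact_imp_fip_image[OF comp, where f = f and I = I]) (rule closed, rule fip)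
  from ne obtain J where J: "J \<in> (\<Inter>p\<in>I. f p)" by (meson IntE ex_in_conv)
  show thesis
  proof (rule that[of J])
    fix u v assume "a \<le> u" "u \<le> v" "v \<le> b"
    then have "(u, v) \<in> I" by (simp add: I_def)
    then have "J \<in> f (u, v)" by (rule INT_D[OF J])
    then show "\<bar>J v - J u - \<Xi> u v\<bar> \<le> 2 / (1 - 2 powr (1 - \<gamma>)) * C * (v - u) powr \<gamma>"
      by (simp add: f_def \<kappa>_def)
  qed
qed

lemma sewing:
  fixes \<Xi> :: "real \<Rightarrow> real \<Rightarrow> real"
  assumes "\<gamma> > 1" and "C \<ge> 0"
    and defect: "\<And>s u t. \<lbrakk>a \<le> s; s < u; u < t; t \<le> b\<rbrakk>
                   \<Longrightarrow> \<bar>\<Xi> s t - \<Xi> s u - \<Xi> u t\<bar> \<le> C * (t - s) powr \<gamma>"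
  obtains K J where "K \<ge> 0" and "\<And>u v. \<lbrakk>a \<le> u; u < v; v \<le> b\<rbrakk>
      \<Longrightarrow> \<bar>J v - J u - \<Xi> u v\<bar> \<le> K * (v - u) powr \<gamma>"
proof -
  \<comment> \<open>The defect bound on the degenerate triple \<open>s = u = t\<close> would force \<open>\<Xi>\<close> to vanish on the
    diagonal.\<close>
  define \<Xi>' where "\<Xi>' = (\<lambda>s t. if s = t then 0 else \<Xi> s t)"
  have "\<bar>\<Xi>' s t - \<Xi>' s u - \<Xi>' u t\<bar> \<le> C * (t - s) powr \<gamma>"
    if "a \<le> s" "s \<le> u" "u \<le> t" "t \<le> b" for s u t
    using defect[of s u t] that \<open>C \<ge> 0\<close> by (auto simp: \<Xi>'_def)
  from sewing_closed[OF assms(1,2) this] obtain J where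
    J: "\<And>u v. \<lbrakk>a \<le> u; u \<le> v; v \<le> b\<rbrakk>
      \<Longrightarrow> \<bar>J v - J u - \<Xi>' u v\<bar> \<le> 2 / (1 - 2 powr (1 - \<gamma>)) * C * (v - u) powr \<gamma>"
    by blast
  have "2 powr (1 - \<gamma>) < 2 powr 0"
    using \<open>\<gamma> > 1\<close> by (intro powr_less_mono; auto)
  then have "0 \<le> 2 / (1 - 2 powr (1 - \<gamma>)) * C" using \<open>C \<ge> 0\<close> by simp
  then show thesis
  proof (rule that)
    fix u v assume "a \<le> u" "u < v" "v \<le> b"
    then show "\<bar>J v - J u - \<Xi> u v\<bar> \<le> 2 / (1 - 2 powr (1 - \<gamma>)) * C * (v - u) powr \<gamma>"
      using J[of u v] by (simp add: \<Xi>'_def)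
  qed
qed

section \<open>Limits of Riemann sums\<close>

lemma partitions_small_mesh:
  assumes "s \<le> t" "d > 0"
  obtains p where "p \<in> partitions s t" "\<bar>mesh p\<bar> < d"
proof (cases "s = t")
  case True
  then have "[s] \<in> partitions s t" "mesh [s] = 0"
    by (auto simp: partitions_def mesh_def)
  then show thesis using that \<open>d > 0\<close> by auto
next
  case False
  then have "s < t" using assms by simp
  obtain n :: nat where n: "(t - s) / d < real n" using reals_Archimedean2 by blast
  moreover have "(t - s) / d > 0" using \<open>s < t\<close> \<open>d > 0\<close> by simp
  ultimately have "real n > 0" by linarith
  then have "n > 0" by simp
  define h where "h = (t - s) / n"
  have "h > 0" using \<open>s < t\<close> \<open>n > 0\<close> by (simp add: h_def)
  have "h < d" using n \<open>n > 0\<close> \<open>d > 0\<close> by (simp add: h_def field_simps)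
  define p where "p = map (\<lambda>i. s + i * h) [0..<Suc n]"
  have len: "length p = Suc n" by (simp add: p_def)
  have nth: "p ! i = s + i * h" if "i < Suc n" for i
    unfolding p_def using that by (simp del: upt_Suc)
  have "p \<noteq> []" using len by auto
  have "p \<in> partitions s t"
    unfolding partitions_def
    using \<open>p \<noteq> []\<close> \<open>h > 0\<close> \<open>n > 0\<close> nth len
    by (auto simp: sorted_wrt_iff_nth_less hd_conv_nth last_conv_nth) (simp add: h_def)
  moreover have "(\<lambda>i. p ! Suc i - p ! i) ` {..<length p - 1} = {h}"
    using nth len \<open>n > 0\<close> by (force simp: algebra_simps)
  then have "mesh p = h"
    unfolding mesh_def using \<open>h > 0\<close> by simp
  ultimately show thesis using that \<open>h > 0\<close> \<open>h < d\<close> by auto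
qed

lemma eventually_mesh_to_zeroI:
  assumes "d > 0" "\<And>p. p \<in> partitions s t \<Longrightarrow> mesh p < d \<Longrightarrow> P p"
  shows "eventually P (mesh_to_zero s t)"
  unfolding mesh_to_zero_def eventually_inf_principal eventually_filtercomap
  using assms order_tendstoD(2)[OF filterlim_ident, of 0 d] by blast

lemma mesh_to_zero_neq_bot:
  assumes "s \<le> t"
  shows "mesh_to_zero s t \<noteq> bot"
proof
  assume "mesh_to_zero s t = bot"
  then have "eventually (\<lambda>_. False) (mesh_to_zero s t)" by simp
  then obtain Q where Q: "eventually Q (nhds (0::real))" "\<And>p. Q (mesh p) \<Longrightarrow> p \<notin> partitions s t"
    unfolding mesh_to_zero_def eventually_inf_principal eventually_filtercomap by auto
  then obtain d where "d > 0" "\<And>y. \<bar>y\<bar> < d \<Longrightarrow> Q y"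
    unfolding eventually_nhds_metric by (auto simp: dist_real_def)
  with Q(2) partitions_small_mesh[OF assms \<open>d > 0\<close>] show False by metis
qed

text \<open>If \<open>\<Xi>\<close> differs from the increments of \<open>G\<close> by
\<open>o(v - u)\<close>, uniformly, then the Riemann sums of \<open>\<Xi>\<close> differ from a telescoping sum by a quantity
that vanishes with the mesh.\<close>

lemma partition_integral_eqI:
  assumes "s \<le> t"
    and near: "\<And>e. e > 0 \<Longrightarrow> \<exists>d>0. \<forall>u v. s \<le> u \<and> u < v \<and> v \<le> t \<and> v - u < d
                  \<longrightarrow> \<bar>G v - G u - \<Xi> u v\<bar> \<le> e * (v - u)"
  shows "partition_integral \<Xi> s t = G t - G s"
  unfolding partition_integral_def
proof (rule tendsto_Lim)
  show "mesh_to_zero s t \<noteq> bot" using mesh_to_zero_neq_bot assms by blast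
  show "((\<lambda>p. \<Sum>i<length p - 1. \<Xi> (p ! i) (p ! Suc i)) \<longlongrightarrow> G t - G s) (mesh_to_zero s t)"
  proof (rule tendstoI)
    fix e :: real assume "e > 0"
    define e' where "e' = e / (t - s + 1)"
    have e': "e' > 0" "e' * (t - s) < e"
      using \<open>e > 0\<close> \<open>s \<le> t\<close> by (auto simp: e'_def field_simps)
    from near[OF e'(1)] obtain d where "d > 0"
      and d: "\<And>u v. \<lbrakk>s \<le> u; u < v; v \<le> t; v - u < d\<rbrakk> \<Longrightarrow> \<bar>G v - G u - \<Xi> u v\<bar> \<le> e' * (v - u)"
      by blast
    show "eventually (\<lambda>p. dist (\<Sum>i<length p - 1. \<Xi> (p ! i) (p ! Suc i)) (G t - G s) < e)
            (mesh_to_zero s t)"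
    proof (rule eventually_mesh_to_zeroI[OF \<open>d > 0\<close>])
      fix p assume p: "p \<in> partitions s t" "mesh p < d"
      define n where "n = length p - 1"
      have "p \<noteq> []" "sorted_wrt (<) p" and ends: "p ! 0 = s" "p ! n = t"
        using p(1) by (auto simp: partitions_def n_def hd_conv_nth last_conv_nth)
      have len: "length p = Suc n" using \<open>p \<noteq> []\<close> by (cases p; auto simp: n_def)
      have less: "p ! i < p ! j" if "i < j" "j \<le> n" for i j
        using \<open>sorted_wrt (<) p\<close> that len by (simp add: sorted_wrt_iff_nth_less)
      have le: "p ! i \<le> p ! j" if "i \<le> j" "j \<le> n" for i j
        using less[of i j] that by (cases "i = j"; auto)
      have step: "\<bar>G (p ! Suc i) - G (p ! i) - \<Xi> (p ! i) (p ! Suc i)\<bar> \<le> e' * (p ! Suc i - p ! i)"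
        if "i < n" for i
      proof (rule d)
        have "p ! Suc i - p ! i \<le> mesh p"
          unfolding mesh_def using that by (intro Max_ge; auto simp: n_def)
        then show "p ! Suc i - p ! i < d" using p(2) by simp
      qed (use that le[of 0 i] le[of "Suc i" n] less[of i "Suc i"] ends in simp)+
      have "(\<Sum>i<n. G (p ! Suc i) - G (p ! i)) = G t - G s"
        using sum_lessThan_telescope[of "\<lambda>i. G (p ! i)" n] ends by simp
      then have "\<bar>G t - G s - (\<Sum>i<n. \<Xi> (p ! i) (p ! Suc i))\<bar>
          = \<bar>\<Sum>i<n. G (p ! Suc i) - G (p ! i) - \<Xi> (p ! i) (p ! Suc i)\<bar>"
        by (simp add: sum_subtractf)
      also have "\<dots> \<le> (\<Sum>i<n. e' * (p ! Suc i - p ! i))"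
        using step by (intro order_trans[OF sum_abs] sum_mono; auto)
      also have "\<dots> = e' * (t - s)"
        using sum_lessThan_telescope[of "\<lambda>i. p ! i" n] ends by (simp flip: sum_distrib_left)
      finally show "dist (\<Sum>i<length p - 1. \<Xi> (p ! i) (p ! Suc i)) (G t - G s) < e"
        using e'(2) by (simp add: dist_real_def n_def abs_minus_commute)
    qed
  qed
qed

lemma powr_le_eps_mult:
  assumes "\<gamma> > 1" "K \<ge> 0" "e > (0::real)"
  shows "\<exists>d>0. \<forall>r. 0 < r \<and> r < d \<longrightarrow> K * r powr \<gamma> \<le> e * r"
proof -
  define d where "d = (e / (K + 1)) powr (1 / (\<gamma> - 1))"
  have "K * r powr \<gamma> \<le> e * r" if "0 < r" "r < d" for r
  proof -
    have "r powr (\<gamma> - 1) \<le> d powr (\<gamma> - 1)"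
      using that \<open>\<gamma> > 1\<close> by (intro powr_mono2; auto)
    also have "\<dots> = e / (K + 1)"
      using \<open>\<gamma> > 1\<close> \<open>e > 0\<close> \<open>K \<ge> 0\<close> by (simp add: d_def powr_powr)
    finally have "K * r powr (\<gamma> - 1) \<le> K * (e / (K + 1))"
      using \<open>K \<ge> 0\<close> by (intro mult_left_mono; auto)
    also have "\<dots> \<le> e" using \<open>K \<ge> 0\<close> \<open>e > 0\<close> by (simp add: field_simps)
    finally have "K * r powr (\<gamma> - 1) * r \<le> e * r"
      using that by (intro mult_right_mono; auto)
    also have "K * r powr (\<gamma> - 1) * r = K * r powr \<gamma>"
      using that by (simp add: powr_diff)
    finally show ?thesis .
  qed
  moreover have "d > 0" using \<open>e > 0\<close> \<open>K \<ge> 0\<close> by (simp add: d_def)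
  ultimately show ?thesis by blast
qed

lemma partition_integral_eqI_powr:
  assumes "s \<le> t" "\<gamma> > 1" "K \<ge> 0"
    and near: "\<And>u v. \<lbrakk>s \<le> u; u < v; v \<le> t\<rbrakk> \<Longrightarrow> \<bar>G v - G u - \<Xi> u v\<bar> \<le> K * (v - u) powr \<gamma>"
  shows "partition_integral \<Xi> s t = G t - G s"
proof (rule partition_integral_eqI[OF \<open>s \<le> t\<close>])
  fix e :: real assume "e > 0"
  with assms(2,3) have "\<exists>d>0. \<forall>r. 0 < r \<and> r < d \<longrightarrow> K * r powr \<gamma> \<le> e * r"
    by (rule powr_le_eps_mult)
  then obtain d where "d > 0" and d: "\<forall>r. 0 < r \<and> r < d \<longrightarrow> K * r powr \<gamma> \<le> e * r"
    by (elim exE conjE)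
  have "\<bar>G v - G u - \<Xi> u v\<bar> \<le> e * (v - u)" if "s \<le> u" "u < v" "v \<le> t" "v - u < d" for u v
    using near[OF that(1-3)] d[rule_format, of "v - u"] that by simp
  with \<open>d > 0\<close> show "\<exists>d>0. \<forall>u v. s \<le> u \<and> u < v \<and> v \<le> t \<and> v - u < d
                  \<longrightarrow> \<bar>G v - G u - \<Xi> u v\<bar> \<le> e * (v - u)"
    by blast
qed

section \<open>Chen's relation and bounds for geometric rough paths\<close>

lemma holder_seminorm_less:
  assumes "holder_seminorm T \<beta> \<Xi> < ennreal e" "e > 0" "0 \<le> s" "s < t" "t \<le> T"
  shows "norm (\<Xi> s t) \<le> e * (t - s) powr \<beta>"
proof -
  have "ennreal (norm (\<Xi> s t) / (t - s) powr \<beta>) \<le> holder_seminorm T \<beta> \<Xi>"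
    unfolding holder_seminorm_def using assms by (intro SUP_upper2[of "(s, t)"]; auto)
  with assms have "ennreal (norm (\<Xi> s t) / (t - s) powr \<beta>) < ennreal e" by (rule_tac le_less_trans)
  then have "norm (\<Xi> s t) / (t - s) powr \<beta> < e" using \<open>e > 0\<close> by (simp add: ennreal_less_iff)
  then show ?thesis using \<open>s < t\<close> by (simp add: divide_less_eq)
qed

lemma holder_seminorm_finite:
  assumes "holder_seminorm T \<beta> \<Xi> < \<infinity>"
  obtains C where "C > 0" "\<And>s t. \<lbrakk>0 \<le> s; s < t; t \<le> T\<rbrakk> \<Longrightarrow> norm (\<Xi> s t) \<le> C * (t - s) powr \<beta>"
proof -
  obtain r where r: "r \<ge> 0" "holder_seminorm T \<beta> \<Xi> = ennreal r"
    using assms by (cases "holder_seminorm T \<beta> \<Xi>"; auto)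
  then have "holder_seminorm T \<beta> \<Xi> < ennreal (r + 1)" by (simp add: ennreal_less_iff)
  then show thesis using that[of "r + 1"] r(1) holder_seminorm_less[of T \<beta> \<Xi> "r + 1"] by auto
qed

lemma powr_le_powr_horizon:
  fixes r T :: real
  assumes "0 \<le> r" "r \<le> T" "\<alpha> \<le> \<beta>"
  shows "r powr \<beta> \<le> T powr (\<beta> - \<alpha>) * r powr \<alpha>"
proof -
  have "r powr \<beta> = r powr (\<beta> - \<alpha>) * r powr \<alpha>" by (simp flip: powr_add)
  also have "\<dots> \<le> T powr (\<beta> - \<alpha>) * r powr \<alpha>"
    using assms by (intro mult_right_mono powr_mono2; auto)
  finally show ?thesis .
qed

text \<open>The lift of a Lipschitz path comes from sewing the germ \<open>W u $ l * incr W u v $ k\<close>, whose defect is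
a product of two Lipschitz increments. Writing the lift through the indefinite integral \<open>G\<close> makes Chen's
relation an algebraic identity, and the quadratic bound is the sewing estimate.\<close>

lemma lipschitz_lift_entry:
  fixes W :: "real \<Rightarrow> real^'k"
  assumes lip: "L-lipschitz_on {0..T} W"
  obtains K G where "K \<ge> 0"
    "\<And>s t. \<lbrakk>0 \<le> s; s \<le> t; t \<le> T\<rbrakk> \<Longrightarrow>
        lipschitz_lift W s t $ l $ k = G t - G s - W s $ l * incr W s t $ k"
    "\<And>s t. \<lbrakk>0 \<le> s; s < t; t \<le> T\<rbrakk> \<Longrightarrow> \<bar>lipschitz_lift W s t $ l $ k\<bar> \<le> K * (t - s) powr 2"
proof -
  define \<Xi> where "\<Xi> = (\<lambda>u v. W u $ l * incr W u v $ k)"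
  have L: "L \<ge> 0" using lip lipschitz_on_nonneg by blast
  have comp: "\<bar>incr W u v $ i\<bar> \<le> L * (v - u)" if "0 \<le> u" "u \<le> v" "v \<le> T" for u v i
  proof -
    have "\<bar>incr W u v $ i\<bar> \<le> norm (incr W u v)" by (rule component_le_norm_cart)
    also have "\<dots> \<le> L * (v - u)"
      using lipschitz_onD[OF lip, of v u] that by (simp add: incr_def dist_norm)
    finally show ?thesis .
  qed
  have defect: "\<bar>\<Xi> s t - \<Xi> s u - \<Xi> u t\<bar> \<le> L\<^sup>2 * (t - s) powr 2" if "0 \<le> s" "s < u" "u < t" "t \<le> T" for s u t
  proof -
    have "\<Xi> s t - \<Xi> s u - \<Xi> u t = - (incr W s u $ l * incr W u t $ k)"
      by (simp add: \<Xi>_def incr_def algebra_simps)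
    also have "\<bar>\<dots>\<bar> \<le> (L * (t - s)) * (L * (t - s))"
      unfolding abs_minus_cancel abs_mult
    proof (rule mult_mono)
      show "\<bar>incr W s u $ l\<bar> \<le> L * (t - s)"
        using comp[of s u l] mult_left_mono[OF _ L, of "u - s" "t - s"] that by simp
      show "\<bar>incr W u t $ k\<bar> \<le> L * (t - s)"
        using comp[of u t k] mult_left_mono[OF _ L, of "t - u" "t - s"] that by simp
    qed (use L that in simp)+
    finally show ?thesis using that by (simp add: power2_eq_square algebra_simps)
  qed
  obtain K G where "K \<ge> 0"
    and G: "\<And>u v. \<lbrakk>0 \<le> u; u < v; v \<le> T\<rbrakk> \<Longrightarrow> \<bar>G v - G u - \<Xi> u v\<bar> \<le> K * (v - u) powr 2"
    by (rule sewing[of 2 "L\<^sup>2" 0 T \<Xi>]) (simp, simp, rule defect, assumption+, rule that)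
  have lift: "lipschitz_lift W s t $ l $ k = G t - G s - W s $ l * incr W s t $ k"
    if st: "0 \<le> s" "s \<le> t" "t \<le> T" for s t
  proof -
    \<comment> \<open>The germ \<open>incr W s u $ l * incr W u v $ k\<close> differs from \<open>\<Xi> u v\<close> by an exact increment.\<close>
    have "partition_integral (\<lambda>u v. incr W s u $ l * incr W u v $ k) s t
        = (G t - W s $ l * W t $ k) - (G s - W s $ l * W s $ k)"
    proof (rule partition_integral_eqI_powr[OF \<open>s \<le> t\<close> _ \<open>K \<ge> 0\<close>, of 2])
      fix u v assume "s \<le> u" "u < v" "v \<le> t"
      moreover have "(G v - W s $ l * W v $ k) - (G u - W s $ l * W u $ k) - incr W s u $ l * incr W u v $ k
          = G v - G u - \<Xi> u v"
        by (simp add: \<Xi>_def incr_def algebra_simps)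
      ultimately show "\<bar>(G v - W s $ l * W v $ k) - (G u - W s $ l * W u $ k)
          - incr W s u $ l * incr W u v $ k\<bar> \<le> K * (v - u) powr 2"
        using G[of u v] st by simp
    qed simp
    then show ?thesis by (simp add: lipschitz_lift_def incr_def algebra_simps)
  qed
  show thesis
  proof (rule that[OF \<open>K \<ge> 0\<close> lift])
    show "\<bar>lipschitz_lift W s t $ l $ k\<bar> \<le> K * (t - s) powr 2" if "0 \<le> s" "s < t" "t \<le> T" for s t
      using G[of s t] lift[of s t] that by (simp add: \<Xi>_def)
  qed
qed

lemma lipschitz_lift_Chen:
  fixes W :: "real \<Rightarrow> real^'k"
  assumes "L-lipschitz_on {0..T} W" and "0 \<le> s" "s \<le> u" "u \<le> t" "t \<le> T"
  shows "lipschitz_lift W s t $ l $ k = lipschitz_lift W s u $ l $ k + lipschitz_lift W u t $ l $ k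
           + incr W s u $ l * incr W u t $ k"
proof -
  obtain G where G: "\<And>s t. \<lbrakk>0 \<le> s; s \<le> t; t \<le> T\<rbrakk> \<Longrightarrow>
      lipschitz_lift W s t $ l $ k = G t - G s - W s $ l * incr W s t $ k"
    using lipschitz_lift_entry[OF assms(1), of l k] by metis
  show ?thesis
    using G[of s t] G[of s u] G[of u t] assms(2-) by (simp add: incr_def algebra_simps)
qed

lemma rough_path_dist_less:
  fixes Z W :: "real \<Rightarrow> real^'k"
  assumes "rough_path_dist T \<alpha> (Z, ZZ) (W, WW) < ennreal e" "e > 0" "0 \<le> s" "s < t" "t \<le> T"
  shows "norm (incr Z s t - incr W s t) \<le> e * (t - s) powr \<alpha>"
    and "norm (ZZ s t - WW s t) \<le> e * (t - s) powr (2 * \<alpha>)"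
proof -
  have lt: "holder_seminorm T \<alpha> (incr (\<lambda>t. Z t - W t)) < ennreal e"
    "holder_seminorm T (2 * \<alpha>) (\<lambda>s t. ZZ s t - WW s t) < ennreal e"
    using assms(1) unfolding rough_path_dist_def
    by (auto intro: le_less_trans[rotated])
  show "norm (incr Z s t - incr W s t) \<le> e * (t - s) powr \<alpha>"
    using holder_seminorm_less[OF lt(1) assms(2-)] by (simp add: incr_def algebra_simps)
  show "norm (ZZ s t - WW s t) \<le> e * (t - s) powr (2 * \<alpha>)"
    using holder_seminorm_less[OF lt(2) assms(2-)] .
qed

lemma geometric_rough_path_approx:
  fixes Z :: "real \<Rightarrow> real^'k"
  assumes "(Z, ZZ) \<in> geometric_rough_paths T \<alpha>" "\<alpha> \<le> 1/2" "e > 0"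
  obtains L W where "L-lipschitz_on {0..T} W"
    "\<And>s t. \<lbrakk>0 \<le> s; s < t; t \<le> T\<rbrakk> \<Longrightarrow> norm (incr Z s t - incr W s t) \<le> e * (t - s) powr \<alpha>"
    "\<And>s t. \<lbrakk>0 \<le> s; s < t; t \<le> T\<rbrakk> \<Longrightarrow> norm (ZZ s t - lipschitz_lift W s t) \<le> e * (t - s) powr (2 * \<alpha>)"
proof -
  have "\<forall>\<epsilon>>0. \<exists>W L. L-lipschitz_on {0..T} W \<and> rough_path_dist T \<alpha> (Z, ZZ) (W, lipschitz_lift W) < \<epsilon>"
    using assms(1,2) by (simp add: geometric_rough_paths_def)
  moreover have "ennreal e > 0" using \<open>e > 0\<close> by simp
  ultimately obtain W L where W: "L-lipschitz_on {0..T} W"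
    "rough_path_dist T \<alpha> (Z, ZZ) (W, lipschitz_lift W) < ennreal e"
    by blast
  show thesis
    using that[OF W(1)] rough_path_dist_less[OF W(2) \<open>e > 0\<close>] by blast
qed

text \<open>Chen's relation is closed under pointwise limits, and convergence in the rough path metric implies
pointwise convergence off the diagonal (the seminorms do not see \<open>s = t\<close>).\<close>

lemma geometric_rough_path_Chen:
  fixes Z :: "real \<Rightarrow> real^'k"
  assumes Z: "(Z, ZZ) \<in> geometric_rough_paths T \<alpha>" "\<alpha> \<le> 1/2"
    and sut: "0 \<le> s" "s < u" "u < t" "t \<le> T"
  shows "ZZ s t $ l $ k = ZZ s u $ l $ k + ZZ u t $ l $ k + incr Z s u $ l * incr Z u t $ k"
proof -
  define e where "e = (\<lambda>n. 1 / real (Suc n))"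
  have "\<exists>W. (\<exists>L. L-lipschitz_on {0..T} W) \<and> (\<forall>s t. 0 \<le> s \<and> s < t \<and> t \<le> T \<longrightarrow>
      norm (incr Z s t - incr W s t) \<le> e n * (t - s) powr \<alpha> \<and>
      norm (ZZ s t - lipschitz_lift W s t) \<le> e n * (t - s) powr (2 * \<alpha>))" for n
    by (rule geometric_rough_path_approx[OF Z, of "e n"]; auto simp: e_def)
  then obtain W where W: "\<And>n. \<exists>L. L-lipschitz_on {0..T} (W n)"
    "\<And>n s t. \<lbrakk>0 \<le> s; s < t; t \<le> T\<rbrakk> \<Longrightarrow> norm (incr Z s t - incr (W n) s t) \<le> e n * (t - s) powr \<alpha>"
    "\<And>n s t. \<lbrakk>0 \<le> s; s < t; t \<le> T\<rbrakk> \<Longrightarrow> norm (ZZ s t - lipschitz_lift (W n) s t) \<le> e n * (t - s) powr (2 * \<alpha>)"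
    by metis
  have e0: "(\<lambda>n. e n * c) \<longlonglongrightarrow> 0" for c
    using tendsto_mult_right[OF LIMSEQ_inverse_real_of_nat, of c] by (simp add: e_def field_simps)
  have lim1: "(\<lambda>n. incr (W n) s t $ i) \<longlonglongrightarrow> incr Z s t $ i" if "0 \<le> s" "s < t" "t \<le> T" for s t i
  proof -
    have "(\<lambda>n. incr Z s t - incr (W n) s t) \<longlonglongrightarrow> 0"
      by (rule Lim_null_comparison[OF _ e0[of "(t - s) powr \<alpha>"]]; (use W(2) that in auto))
    then have "(\<lambda>n. incr Z s t - (incr Z s t - incr (W n) s t)) \<longlonglongrightarrow> incr Z s t - 0"
      by (intro tendsto_diff tendsto_const)
    then show ?thesis by (intro tendsto_vec_nth) simp
  qed
  have lim2: "(\<lambda>n. lipschitz_lift (W n) s t $ l $ k) \<longlonglongrightarrow> ZZ s t $ l $ k" if "0 \<le> s" "s < t" "t \<le> T" for s t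
  proof -
    have "(\<lambda>n. ZZ s t - lipschitz_lift (W n) s t) \<longlonglongrightarrow> 0"
      by (rule Lim_null_comparison[OF _ e0[of "(t - s) powr (2 * \<alpha>)"]]; (use W(3) that in auto))
    then have "(\<lambda>n. ZZ s t - (ZZ s t - lipschitz_lift (W n) s t)) \<longlonglongrightarrow> ZZ s t - 0"
      by (intro tendsto_diff tendsto_const)
    then show ?thesis by (intro tendsto_vec_nth) simp
  qed
  have "lipschitz_lift (W n) s t $ l $ k = lipschitz_lift (W n) s u $ l $ k
      + lipschitz_lift (W n) u t $ l $ k + incr (W n) s u $ l * incr (W n) u t $ k" for n
    using W(1)[of n] sut lipschitz_lift_Chen[of _ T "W n" s u t l k] by auto
  then have "(\<lambda>n. lipschitz_lift (W n) s t $ l $ k)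
      \<longlonglongrightarrow> ZZ s u $ l $ k + ZZ u t $ l $ k + incr Z s u $ l * incr Z u t $ k"
    using sut by (simp only:) (intro tendsto_intros lim1 lim2; simp)
  with lim2[of s t] sut show ?thesis using LIMSEQ_unique by fastforce
qed

text \<open>A single Lipschitz path at distance less than 1 suffices: Lipschitz increments and the quadratic bound on
their lift are stronger than the Hoelder bounds on a bounded interval.\<close>

lemma geometric_rough_path_bounds:
  fixes Z :: "real \<Rightarrow> real^'k"
  assumes Z: "(Z, ZZ) \<in> geometric_rough_paths T \<alpha>" "\<alpha> \<le> 1/2"
  obtains C D where "C \<ge> 0" "D \<ge> 0"
    "\<And>s t. \<lbrakk>0 \<le> s; s < t; t \<le> T\<rbrakk> \<Longrightarrow> norm (incr Z s t) \<le> C * (t - s) powr \<alpha>"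
    "\<And>s t. \<lbrakk>0 \<le> s; s < t; t \<le> T\<rbrakk> \<Longrightarrow> norm (ZZ s t) \<le> D * (t - s) powr (2 * \<alpha>)"
proof -
  obtain W L where W: "L-lipschitz_on {0..T} W"
    "\<And>s t. \<lbrakk>0 \<le> s; s < t; t \<le> T\<rbrakk> \<Longrightarrow> norm (incr Z s t - incr W s t) \<le> 1 * (t - s) powr \<alpha>"
    "\<And>s t. \<lbrakk>0 \<le> s; s < t; t \<le> T\<rbrakk> \<Longrightarrow> norm (ZZ s t - lipschitz_lift W s t) \<le> 1 * (t - s) powr (2 * \<alpha>)"
    by (rule geometric_rough_path_approx[OF Z zero_less_one]) (rule that)
  have L: "L \<ge> 0" using W(1) lipschitz_on_nonneg by blast
  have "\<exists>K\<ge>0. \<forall>s t. 0 \<le> s \<and> s < t \<and> t \<le> T \<longrightarrow> \<bar>lipschitz_lift W s t $ l $ k\<bar> \<le> K * (t - s) powr 2" for l k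
    by (rule lipschitz_lift_entry[OF W(1), of l k]; auto)
  then obtain K where K: "\<And>l k. K l k \<ge> 0"
    "\<And>l k s t. \<lbrakk>0 \<le> s; s < t; t \<le> T\<rbrakk> \<Longrightarrow> \<bar>lipschitz_lift W s t $ l $ k\<bar> \<le> K l k * (t - s) powr 2"
    by metis
  define C where "C = L * T powr (1 - \<alpha>) + 1"
  define D where "D = (\<Sum>l\<in>UNIV. \<Sum>k\<in>UNIV. K l k) * T powr (2 - 2 * \<alpha>) + 1"
  show thesis
  proof
    show "C \<ge> 0" using L by (simp add: C_def)
    show "D \<ge> 0" using K by (simp add: D_def sum_nonneg)
  next
    fix s t :: real assume st: "0 \<le> s" "s < t" "t \<le> T"
    have "norm (incr W s t) \<le> L * (t - s) powr 1"
      using lipschitz_onD[OF W(1), of t s] st by (simp add: incr_def dist_norm)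
    also have "\<dots> \<le> L * (T powr (1 - \<alpha>) * (t - s) powr \<alpha>)"
      using st L assms by (intro mult_left_mono powr_le_powr_horizon; auto)
    finally have "norm (incr W s t) + norm (incr Z s t - incr W s t)
        \<le> L * (T powr (1 - \<alpha>) * (t - s) powr \<alpha>) + 1 * (t - s) powr \<alpha>"
      using W(2)[OF st] by (rule add_mono)
    then show "norm (incr Z s t) \<le> C * (t - s) powr \<alpha>"
      using norm_triangle_sub[of "incr Z s t" "incr W s t"] by (simp add: C_def algebra_simps)
    have "norm (lipschitz_lift W s t) \<le> (\<Sum>l\<in>UNIV. norm (lipschitz_lift W s t $ l))"
      unfolding norm_vec_def by (rule L2_set_le_sum) simp
    also have "\<dots> \<le> (\<Sum>l\<in>UNIV. \<Sum>k\<in>UNIV. K l k * (t - s) powr 2)"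
      using K(2)[OF st] by (intro sum_mono order_trans[OF norm_le_l1_cart]; auto)
    also have "\<dots> = (\<Sum>l\<in>UNIV. \<Sum>k\<in>UNIV. K l k) * (t - s) powr 2"
      by (simp add: sum_distrib_right)
    also have "\<dots> \<le> (\<Sum>l\<in>UNIV. \<Sum>k\<in>UNIV. K l k) * (T powr (2 - 2 * \<alpha>) * (t - s) powr (2 * \<alpha>))"
      using st K assms by (intro mult_left_mono powr_le_powr_horizon sum_nonneg; auto)
    finally have "norm (lipschitz_lift W s t) + norm (ZZ s t - lipschitz_lift W s t)
        \<le> (\<Sum>l\<in>UNIV. \<Sum>k\<in>UNIV. K l k) * (T powr (2 - 2 * \<alpha>) * (t - s) powr (2 * \<alpha>))
          + 1 * (t - s) powr (2 * \<alpha>)"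
      using W(3)[OF st] by (rule add_mono)
    then show "norm (ZZ s t) \<le> D * (t - s) powr (2 * \<alpha>)"
      using norm_triangle_sub[of "ZZ s t" "lipschitz_lift W s t"] by (simp add: D_def algebra_simps)
  qed
qed

section \<open>The germ of the rough integral\<close>

lemma rough_integral_germ:
  fixes Z Y :: "real \<Rightarrow> real^'k"
  shows "rough_integral (Y, Y') (Z, ZZ) s t
      = partition_integral (\<lambda>u v. Y u \<bullet> incr Z u v + Y' u \<bullet> ZZ u v) s t"
proof -
  have "Y' u \<bullet> ZZ u v = (\<Sum>k\<in>UNIV. \<Sum>l\<in>UNIV. Y' u $ l $ k * ZZ u v $ l $ k)" for u v
    unfolding inner_vec_def inner_real_def by (rule sum.swap)
  moreover have "Y u \<bullet> incr Z u v = (\<Sum>k\<in>UNIV. Y u $ k * incr Z u v $ k)" for u v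
    by (simp add: inner_vec_def)
  ultimately show ?thesis by (simp add: rough_integral_def)
qed

text \<open>The cancellation on which rough integration rests. By Chen's relation the second-level term produces
exactly the product of increments that turns the increment of \<open>Y\<close> into its remainder, so both
remaining terms are of order \<open>3 \<alpha>\<close>.\<close>

lemma rough_germ_defect:
  fixes Z Y :: "real \<Rightarrow> real^'k" and ZZ :: "real \<Rightarrow> real \<Rightarrow> real^'k^'k" and Y' :: "real \<Rightarrow> real^'k^'k"
  assumes Chen: "\<And>l k. ZZ s t $ l $ k = ZZ s u $ l $ k + ZZ u t $ l $ k + incr Z s u $ l * incr Z u t $ k"
  shows "(Y s \<bullet> incr Z s t + Y' s \<bullet> ZZ s t) - (Y s \<bullet> incr Z s u + Y' s \<bullet> ZZ s u)
           - (Y u \<bullet> incr Z u t + Y' u \<bullet> ZZ u t)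
         = - ((incr Y s u - (\<Sum>l\<in>UNIV. incr Z s u $ l *\<^sub>R Y' s $ l)) \<bullet> incr Z u t)
           - incr Y' s u \<bullet> ZZ u t"
proof -
  define M :: "real^'k^'k" where "M = (\<chi> l k. incr Z s u $ l * incr Z u t $ k)"
  have ZZ: "ZZ s t = ZZ s u + ZZ u t + M"
    by (simp add: vec_eq_iff M_def Chen)
  have M: "Y' s \<bullet> M = (\<Sum>l\<in>UNIV. incr Z s u $ l *\<^sub>R Y' s $ l) \<bullet> incr Z u t"
    by (simp add: M_def inner_vec_def[of _ "_ :: real^'k^'k"] inner_sum_left)
      (simp add: inner_vec_def sum_distrib_left mult_ac)
  have Z: "incr Z s t = incr Z s u + incr Z u t" by (simp add: incr_def)
  show ?thesis
    unfolding ZZ Z by (simp add: inner_add_right inner_diff_left M incr_def[of Y] incr_def[of Y'])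
qed

lemma holder_path_bounded:
  fixes f :: "real \<Rightarrow> 'e::real_normed_vector"
  assumes "C \<ge> 0" "\<alpha> \<ge> 0"
    and C: "\<And>s t. \<lbrakk>0 \<le> s; s < t; t \<le> T\<rbrakk> \<Longrightarrow> norm (incr f s t) \<le> C * (t - s) powr \<alpha>"
    and u: "0 \<le> u" "u \<le> T"
  shows "norm (f u) \<le> norm (f 0) + C * T powr \<alpha>"
proof (cases "u = 0")
  case True
  then show ?thesis using \<open>C \<ge> 0\<close> by simp
next
  case False
  then have "norm (f u - f 0) \<le> C * u powr \<alpha>" using C[of 0 u] u by (simp add: incr_def)
  also have "\<dots> \<le> C * T powr \<alpha>"
    using u assms(1,2) by (intro mult_left_mono powr_mono2; simp)
  finally show ?thesis using norm_triangle_sub[of "f u" "f 0"] by linarith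
qed

lemma abs_inner_powr_bound:
  fixes x y :: "'e::real_inner"
  assumes x: "norm x \<le> A * p powr \<beta>" and y: "norm y \<le> B * q powr \<delta>"
    and nonneg: "A \<ge> 0" "B \<ge> 0" "\<beta> \<ge> 0" "\<delta> \<ge> 0" and r: "0 \<le> p" "p \<le> r" "0 \<le> q" "q \<le> r"
  shows "\<bar>x \<bullet> y\<bar> \<le> (A * B) * r powr (\<beta> + \<delta>)"
proof -
  have "\<bar>x \<bullet> y\<bar> \<le> norm x * norm y" by (rule Cauchy_Schwarz_ineq2)
  also have "\<dots> \<le> (A * p powr \<beta>) * (B * q powr \<delta>)"
    by (rule mult_mono[OF x y]) (simp_all add: nonneg)
  also have "\<dots> = (A * B) * (p powr \<beta> * q powr \<delta>)" by simp
  also have "\<dots> \<le> (A * B) * (r powr \<beta> * r powr \<delta>)"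
    using nonneg r by (intro mult_left_mono mult_mono powr_mono2; simp)
  finally show ?thesis by (simp add: powr_add)
qed

text \<open>The rough regime: the defect has order \<open>3 \<alpha>\<close>. The bound of order \<open>\<alpha>\<close> on the germ itself is what
makes its indefinite integral continuous.\<close>

lemma rough_germ_bounds:
  fixes Z Y :: "real \<Rightarrow> real^'k" and ZZ :: "real \<Rightarrow> real \<Rightarrow> real^'k^'k" and Y' :: "real \<Rightarrow> real^'k^'k"
  defines "\<Xi> \<equiv> \<lambda>u v. Y u \<bullet> incr Z u v + Y' u \<bullet> ZZ u v"
  assumes "0 < \<alpha>" "\<alpha> \<le> 1/2"
    and Z: "(Z, ZZ) \<in> geometric_rough_paths T \<alpha>"
    and Y: "(Y, Y') \<in> controlled_paths T \<alpha> Z"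
  obtains C B where "C \<ge> 0"
    "\<And>s u t. \<lbrakk>0 \<le> s; s < u; u < t; t \<le> T\<rbrakk> \<Longrightarrow> \<bar>\<Xi> s t - \<Xi> s u - \<Xi> u t\<bar> \<le> C * (t - s) powr (3 * \<alpha>)"
    "\<And>u v. \<lbrakk>0 \<le> u; u < v; v \<le> T\<rbrakk> \<Longrightarrow> \<bar>\<Xi> u v\<bar> \<le> B * (v - u) powr \<alpha>"
proof -
  obtain CZ DZ where "CZ \<ge> 0" "DZ \<ge> 0"
    and CZ: "\<And>s t. \<lbrakk>0 \<le> s; s < t; t \<le> T\<rbrakk> \<Longrightarrow> norm (incr Z s t) \<le> CZ * (t - s) powr \<alpha>"
    and DZ: "\<And>s t. \<lbrakk>0 \<le> s; s < t; t \<le> T\<rbrakk> \<Longrightarrow> norm (ZZ s t) \<le> DZ * (t - s) powr (2 * \<alpha>)"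
    by (rule geometric_rough_path_bounds[OF Z \<open>\<alpha> \<le> 1/2\<close>]) (rule that)
  define R where "R = (\<lambda>s t. incr Y s t - (\<Sum>k\<in>UNIV. incr Z s t $ k *\<^sub>R Y' s $ k))"
  have fin: "holder_seminorm T \<alpha> (incr Y) < \<infinity>" "holder_seminorm T \<alpha> (incr Y') < \<infinity>"
    "holder_seminorm T (2 * \<alpha>) R < \<infinity>"
    using Y \<open>\<alpha> \<le> 1/2\<close> by (simp_all add: controlled_paths_def holder_paths_def holder_maps2_def R_def)
  obtain CY where CY: "CY > 0" "\<And>s t. \<lbrakk>0 \<le> s; s < t; t \<le> T\<rbrakk> \<Longrightarrow> norm (incr Y s t) \<le> CY * (t - s) powr \<alpha>"
    by (rule holder_seminorm_finite[OF fin(1)]) (rule that)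
  obtain CY' where CY': "CY' > 0" "\<And>s t. \<lbrakk>0 \<le> s; s < t; t \<le> T\<rbrakk> \<Longrightarrow> norm (incr Y' s t) \<le> CY' * (t - s) powr \<alpha>"
    by (rule holder_seminorm_finite[OF fin(2)]) (rule that)
  obtain CR where CR: "CR > 0" "\<And>s t. \<lbrakk>0 \<le> s; s < t; t \<le> T\<rbrakk> \<Longrightarrow> norm (R s t) \<le> CR * (t - s) powr (2 * \<alpha>)"
    by (rule holder_seminorm_finite[OF fin(3)]) (rule that)
  define N where "N = norm (Y 0) + CY * T powr \<alpha>"
  define N' where "N' = norm (Y' 0) + CY' * T powr \<alpha>"
  have N: "norm (Y u) \<le> N" "norm (Y' u) \<le> N'" if "0 \<le> u" "u \<le> T" for u
    unfolding N_def N'_def using CY CY' \<open>0 < \<alpha>\<close> that by (intro holder_path_bounded; simp)+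
  have "\<bar>\<Xi> s t - \<Xi> s u - \<Xi> u t\<bar> \<le> (CR * CZ + CY' * DZ) * (t - s) powr (3 * \<alpha>)"
    if sut: "0 \<le> s" "s < u" "u < t" "t \<le> T" for s u t
  proof -
    have "\<Xi> s t - \<Xi> s u - \<Xi> u t = - (R s u \<bullet> incr Z u t) - incr Y' s u \<bullet> ZZ u t"
      unfolding \<Xi>_def R_def
      by (intro rough_germ_defect geometric_rough_path_Chen[OF Z \<open>\<alpha> \<le> 1/2\<close> sut])
    moreover have "\<bar>R s u \<bullet> incr Z u t\<bar> \<le> (CR * CZ) * (t - s) powr (2 * \<alpha> + \<alpha>)"
      by (rule abs_inner_powr_bound[OF CR(2) CZ]) (use sut CR(1) \<open>CZ \<ge> 0\<close> \<open>0 < \<alpha>\<close> in simp_all)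
    moreover have "\<bar>incr Y' s u \<bullet> ZZ u t\<bar> \<le> (CY' * DZ) * (t - s) powr (\<alpha> + 2 * \<alpha>)"
      by (rule abs_inner_powr_bound[OF CY'(2) DZ]) (use sut CY'(1) \<open>DZ \<ge> 0\<close> \<open>0 < \<alpha>\<close> in simp_all)
    ultimately show ?thesis by (simp add: algebra_simps)
  qed
  moreover have "\<bar>\<Xi> u v\<bar> \<le> (N * CZ + N' * (DZ * T powr \<alpha>)) * (v - u) powr \<alpha>"
    if uv: "0 \<le> u" "u < v" "v \<le> T" for u v
  proof -
    have n: "norm (Y u) \<le> N" "norm (Y' u) \<le> N'" using N[of u] uv by simp_all
    have "norm (ZZ u v) \<le> DZ * (v - u) powr (2 * \<alpha>)" using DZ uv .
    also have "\<dots> \<le> DZ * (T powr \<alpha> * (v - u) powr \<alpha>)"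
      using powr_le_powr_horizon[of "v - u" T \<alpha> "2 * \<alpha>"] uv \<open>DZ \<ge> 0\<close> \<open>0 < \<alpha>\<close>
      by (intro mult_left_mono) simp_all
    finally have "norm (Y' u) * norm (ZZ u v) \<le> N' * (DZ * (T powr \<alpha> * (v - u) powr \<alpha>))"
      by (rule mult_mono'[OF n(2)]) simp_all
    moreover have "norm (Y u) * norm (incr Z u v) \<le> N * (CZ * (v - u) powr \<alpha>)"
      by (rule mult_mono'[OF n(1) CZ[OF uv]]) simp_all
    ultimately have "\<bar>\<Xi> u v\<bar> \<le> N * (CZ * (v - u) powr \<alpha>) + N' * (DZ * (T powr \<alpha> * (v - u) powr \<alpha>))"
      using Cauchy_Schwarz_ineq2[of "Y u" "incr Z u v"] Cauchy_Schwarz_ineq2[of "Y' u" "ZZ u v"]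
      unfolding \<Xi>_def by linarith
    then show ?thesis by (simp add: algebra_simps)
  qed
  moreover have "CR * CZ + CY' * DZ \<ge> 0" using CR(1) CY'(1) \<open>CZ \<ge> 0\<close> \<open>DZ \<ge> 0\<close> by simp
  ultimately show thesis using that by metis
qed

text \<open>The Young regime: without a second level the defect is a single product of increments, of order
\<open>2 \<alpha>\<close>.\<close>

lemma Young_germ_bounds:
  fixes Z Y :: "real \<Rightarrow> real^'k" and ZZ :: "real \<Rightarrow> real \<Rightarrow> real^'k^'k" and Y' :: "real \<Rightarrow> real^'k^'k"
  defines "\<Xi> \<equiv> \<lambda>u v. Y u \<bullet> incr Z u v + Y' u \<bullet> ZZ u v"
  assumes "1/2 < \<alpha>"
    and Z: "(Z, ZZ) \<in> geometric_rough_paths T \<alpha>"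
    and Y: "(Y, Y') \<in> controlled_paths T \<alpha> Z"
  obtains C B where "C \<ge> 0"
    "\<And>s u t. \<lbrakk>0 \<le> s; s < u; u < t; t \<le> T\<rbrakk> \<Longrightarrow> \<bar>\<Xi> s t - \<Xi> s u - \<Xi> u t\<bar> \<le> C * (t - s) powr (2 * \<alpha>)"
    "\<And>u v. \<lbrakk>0 \<le> u; u < v; v \<le> T\<rbrakk> \<Longrightarrow> \<bar>\<Xi> u v\<bar> \<le> B * (v - u) powr \<alpha>"
proof -
  have fin: "holder_seminorm T \<alpha> (incr Z) < \<infinity>" "holder_seminorm T \<alpha> (incr Y) < \<infinity>"
    and zero: "ZZ = (\<lambda>_ _. 0)" "Y' = (\<lambda>_. 0)"
    using Z Y \<open>1/2 < \<alpha>\<close> by (simp_all add: geometric_rough_paths_def controlled_paths_def holder_paths_def)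
  have \<Xi>: "\<Xi> u v = Y u \<bullet> incr Z u v" for u v
    by (simp add: \<Xi>_def zero)
  obtain CZ where CZ: "CZ > 0" "\<And>s t. \<lbrakk>0 \<le> s; s < t; t \<le> T\<rbrakk> \<Longrightarrow> norm (incr Z s t) \<le> CZ * (t - s) powr \<alpha>"
    by (rule holder_seminorm_finite[OF fin(1)]) (rule that)
  obtain CY where CY: "CY > 0" "\<And>s t. \<lbrakk>0 \<le> s; s < t; t \<le> T\<rbrakk> \<Longrightarrow> norm (incr Y s t) \<le> CY * (t - s) powr \<alpha>"
    by (rule holder_seminorm_finite[OF fin(2)]) (rule that)
  have "\<bar>\<Xi> s t - \<Xi> s u - \<Xi> u t\<bar> \<le> (CY * CZ) * (t - s) powr (2 * \<alpha>)"
    if sut: "0 \<le> s" "s < u" "u < t" "t \<le> T" for s u t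
  proof -
    have "\<Xi> s t - \<Xi> s u - \<Xi> u t = - (incr Y s u \<bullet> incr Z u t)"
      by (simp add: \<Xi> incr_def inner_diff_left inner_diff_right)
    moreover have "\<bar>incr Y s u \<bullet> incr Z u t\<bar> \<le> (CY * CZ) * (t - s) powr (\<alpha> + \<alpha>)"
      by (rule abs_inner_powr_bound[OF CY(2) CZ(2)]) (use sut CY(1) CZ(1) \<open>1/2 < \<alpha>\<close> in simp_all)
    ultimately show ?thesis by simp
  qed
  moreover have "\<bar>\<Xi> u v\<bar> \<le> ((norm (Y 0) + CY * T powr \<alpha>) * CZ) * (v - u) powr \<alpha>"
    if uv: "0 \<le> u" "u < v" "v \<le> T" for u v
  proof -
    have "norm (Y u) \<le> norm (Y 0) + CY * T powr \<alpha>"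
      using CY \<open>1/2 < \<alpha>\<close> uv by (intro holder_path_bounded; simp)
    then have "norm (Y u) * norm (incr Z u v) \<le> (norm (Y 0) + CY * T powr \<alpha>) * (CZ * (v - u) powr \<alpha>)"
      by (rule mult_mono'[OF _ CZ(2)[OF uv]]) simp_all
    then show ?thesis
      using Cauchy_Schwarz_ineq2[of "Y u" "incr Z u v"] by (simp add: \<Xi> mult.assoc)
  qed
  moreover have "CY * CZ \<ge> 0" using CY(1) CZ(1) by simp
  ultimately show thesis using that by metis
qed

lemma continuous_on_powr_modulus:
  fixes J :: "real \<Rightarrow> real"
  assumes "\<alpha> > 0" "\<gamma> > 0"
    and bound: "\<And>u v. \<lbrakk>a \<le> u; u < v; v \<le> b\<rbrakk> \<Longrightarrow> \<bar>J v - J u\<bar> \<le> B * (v - u) powr \<alpha> + K * (v - u) powr \<gamma>"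
  shows "continuous_on {a..b} J"
proof -
  have "(J \<longlongrightarrow> J x) (at x within {a..b})" if "x \<in> {a..b}" for x
  proof -
    have lim: "((\<lambda>y. B * \<bar>y - x\<bar> powr \<alpha> + K * \<bar>y - x\<bar> powr \<gamma>) \<longlongrightarrow> B * \<bar>x - x\<bar> powr \<alpha> + K * \<bar>x - x\<bar> powr \<gamma>)
            (at x within {a..b})"
      using assms(1,2) by (intro tendsto_intros tendsto_powr'; auto)
    have ev: "eventually (\<lambda>y. norm (J y - J x) \<le> B * \<bar>y - x\<bar> powr \<alpha> + K * \<bar>y - x\<bar> powr \<gamma>)
            (at x within {a..b})"
      unfolding eventually_at_filter
    proof (intro always_eventually allI impI)
      fix y assume "y \<noteq> x" "y \<in> {a..b}"
      then show "norm (J y - J x) \<le> B * \<bar>y - x\<bar> powr \<alpha> + K * \<bar>y - x\<bar> powr \<gamma>"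
        using bound[of x y] bound[of y x] that
        by (cases "x < y"; simp add: abs_minus_commute)
    qed
    have "((\<lambda>y. J y - J x) \<longlongrightarrow> 0) (at x within {a..b})"
      using lim by (intro Lim_null_comparison[OF ev]) simp
    then show ?thesis by (simp add: LIM_zero_iff)
  qed
  then show ?thesis by (simp add: continuous_on_def)
qed

section \<open>Integration of a weighted germ by parts\<close>

lemma has_integral_real_derivative:
  assumes "a \<le> b" "\<And>x. (f has_real_derivative f' x) (at x)"
  shows "(f' has_integral f b - f a) {a..b}"
proof (rule fundamental_theorem_of_calculus[OF \<open>a \<le> b\<close>])
  show "(f has_vector_derivative f' x) (at x within {a..b})" for x
    using has_vector_derivative_at_within assms(2)
    unfolding has_real_derivative_iff_has_vector_derivative by blast
qed

lemma continuous_on_Icc_bounded: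
  fixes f :: "real \<Rightarrow> real"
  assumes "continuous_on {a..b} f"
  obtains B where "B > 0" "\<And>t. t \<in> {a..b} \<Longrightarrow> \<bar>f t\<bar> \<le> B"
proof -
  have "bounded (f ` {a..b})"
    by (intro compact_imp_bounded compact_continuous_image assms) simp
  then obtain B where "B > 0" "\<forall>y\<in>f ` {a..b}. norm y \<le> B" unfolding bounded_pos by blast
  then show thesis by (intro that[of B]; simp)
qed

text \<open>If \<open>\<Xi>\<close> is sewn to \<open>J\<close>, then \<open>\<phi> u * \<Xi> u v\<close> is sewn to \<open>\<phi> * J\<close> minus the integral of
\<open>J * \<phi>'\<close>: replacing \<open>\<Xi>\<close> by the increment of \<open>J\<close> costs \<open>O((v - u) powr \<gamma>)\<close>, and
integration by parts leaves an error controlled by the oscillation of \<open>J\<close>. For the germ of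
a controlled path this reduces the rough integral of its product with \<open>\<phi>\<close> to an ordinary integral.\<close>

lemma partition_integral_weighted_germ:
  fixes J \<phi> \<phi>' :: "real \<Rightarrow> real"
  assumes "a \<le> b" "\<gamma> > 1" "K \<ge> 0"
    and near: "\<And>u v. \<lbrakk>a \<le> u; u < v; v \<le> b\<rbrakk> \<Longrightarrow> \<bar>J v - J u - \<Xi> u v\<bar> \<le> K * (v - u) powr \<gamma>"
    and J: "continuous_on {a..b} J"
    and \<phi>: "\<And>x. (\<phi> has_real_derivative \<phi>' x) (at x)" and \<phi>': "continuous_on {a..b} \<phi>'"
  shows "partition_integral (\<lambda>u v. \<phi> u * \<Xi> u v) a b
           = \<phi> b * J b - \<phi> a * J a - integral {a..b} (\<lambda>t. J t * \<phi>' t)"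
proof -
  define G where "G = (\<lambda>t. \<phi> t * J t - integral {a..t} (\<lambda>r. J r * \<phi>' r))"
  have "continuous_on {a..b} \<phi>"
    using \<phi> by (meson DERIV_isCont continuous_at_imp_continuous_on)
  obtain M1 where M1: "M1 > 0" "\<And>t. t \<in> {a..b} \<Longrightarrow> \<bar>\<phi> t\<bar> \<le> M1"
    by (rule continuous_on_Icc_bounded[OF \<open>continuous_on {a..b} \<phi>\<close>]) (rule that)
  obtain M2 where M2: "M2 > 0" "\<And>t. t \<in> {a..b} \<Longrightarrow> \<bar>\<phi>' t\<bar> \<le> M2"
    by (rule continuous_on_Icc_bounded[OF \<phi>']) (rule that)
  define M where "M = max M1 M2"
  have "M > 0" and M: "\<And>t. t \<in> {a..b} \<Longrightarrow> \<bar>\<phi> t\<bar> \<le> M" "\<And>t. t \<in> {a..b} \<Longrightarrow> \<bar>\<phi>' t\<bar> \<le> M"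
    using M1 M2 by (auto simp: M_def le_max_iff_disj)
  have increment: "\<bar>G v - G u - \<phi> u * \<Xi> u v\<bar> \<le> (\<omega> * M) * (v - u) + M * (K * (v - u) powr \<gamma>)"
    if uv: "a \<le> u" "u < v" "v \<le> b" and osc: "\<And>r. r \<in> {u..v} \<Longrightarrow> \<bar>J v - J r\<bar> \<le> \<omega>" for u v \<omega>
  proof -
    have cont: "continuous_on {u..v} J" "continuous_on {u..v} \<phi>'"
      using uv by (auto intro: continuous_on_subset[OF J] continuous_on_subset[OF \<phi>'])
    have "continuous_on {a..v} (\<lambda>r. J r * \<phi>' r)"
      using uv by (intro continuous_on_subset[OF continuous_on_mult[OF J \<phi>']]) simp
    then have "integral {a..u} (\<lambda>r. J r * \<phi>' r) + integral {u..v} (\<lambda>r. J r * \<phi>' r)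
        = integral {a..v} (\<lambda>r. J r * \<phi>' r)"
      using uv by (intro Henstock_Kurzweil_Integration.integral_combine integrable_continuous_real; simp)
    moreover have "(\<phi>' has_integral \<phi> v - \<phi> u) {u..v}"
      using has_integral_real_derivative[of u v \<phi>, OF _ \<phi>] uv by simp
    then have "integral {u..v} (\<lambda>r. J v * \<phi>' r) = J v * (\<phi> v - \<phi> u)"
      by (simp add: integral_unique)
    moreover have "integral {u..v} (\<lambda>r. (J v - J r) * \<phi>' r)
        = integral {u..v} (\<lambda>r. J v * \<phi>' r) - integral {u..v} (\<lambda>r. J r * \<phi>' r)"
      unfolding left_diff_distrib using cont
      by (intro integral_diff integrable_continuous_real continuous_intros)
    \<comment> \<open>Summation by parts on a single interval.\<close>
    ultimately have "G v - G u - \<phi> u * \<Xi> u v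
        = integral {u..v} (\<lambda>r. (J v - J r) * \<phi>' r) + \<phi> u * (J v - J u - \<Xi> u v)"
      by (simp add: G_def algebra_simps)
    moreover have "norm (integral {u..v} (\<lambda>r. (J v - J r) * \<phi>' r)) \<le> (\<omega> * M) * (v - u)"
    proof (rule integral_bound)
      show "norm ((J v - J r) * \<phi>' r) \<le> \<omega> * M" if "r \<in> {u..v}" for r
        unfolding real_norm_def abs_mult
        using osc[OF that] M(2)[of r] osc[of v] that uv by (intro mult_mono; simp)
      show "continuous_on {u..v} (\<lambda>r. (J v - J r) * \<phi>' r)"
        using cont by (intro continuous_intros)
    qed (use uv in simp)
    moreover have "\<bar>\<phi> u * (J v - J u - \<Xi> u v)\<bar> \<le> M * (K * (v - u) powr \<gamma>)"
      unfolding abs_mult using near[OF uv(1-3)] M(1)[of u] uv(1-3) \<open>M > 0\<close> by (intro mult_mono; simp)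
    ultimately show ?thesis unfolding real_norm_def by linarith
  qed
  have "partition_integral (\<lambda>u v. \<phi> u * \<Xi> u v) a b = G b - G a"
  proof (rule partition_integral_eqI[OF \<open>a \<le> b\<close>])
    fix e :: real assume "e > 0"
    define \<omega> where "\<omega> = e / (2 * M)"
    have "\<omega> > 0" using \<open>e > 0\<close> \<open>M > 0\<close> by (simp add: \<omega>_def)
    have "uniformly_continuous_on {a..b} J" using J by (simp add: compact_uniformly_continuous)
    then have "\<exists>d>0. \<forall>x\<in>{a..b}. \<forall>y\<in>{a..b}. dist y x < d \<longrightarrow> dist (J y) (J x) < \<omega>"
      using \<open>\<omega> > 0\<close> by (simp only: uniformly_continuous_on_def)
    then obtain d1 where "d1 > 0"
      and d1: "\<And>x y. \<lbrakk>x \<in> {a..b}; y \<in> {a..b}; \<bar>y - x\<bar> < d1\<rbrakk> \<Longrightarrow> \<bar>J y - J x\<bar> < \<omega>"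
      unfolding dist_real_def by blast
    have "\<exists>d>0. \<forall>r. 0 < r \<and> r < d \<longrightarrow> (M * K) * r powr \<gamma> \<le> (e / 2) * r"
      using assms(2,3) \<open>M > 0\<close> \<open>e > 0\<close> by (intro powr_le_eps_mult; auto)
    then obtain d2 where "d2 > 0" and d2: "\<And>r. \<lbrakk>0 < r; r < d2\<rbrakk> \<Longrightarrow> (M * K) * r powr \<gamma> \<le> (e / 2) * r"
      by blast
    have "\<bar>G v - G u - \<phi> u * \<Xi> u v\<bar> \<le> e * (v - u)"
      if uv: "a \<le> u" "u < v" "v \<le> b" "v - u < min d1 d2" for u v
    proof -
      have "\<bar>G v - G u - \<phi> u * \<Xi> u v\<bar> \<le> (\<omega> * M) * (v - u) + M * (K * (v - u) powr \<gamma>)"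
      proof (rule increment[OF uv(1-3)])
        show "\<bar>J v - J r\<bar> \<le> \<omega>" if "r \<in> {u..v}" for r
          using d1[of r v] that uv by simp
      qed
      also have "\<dots> \<le> (e / 2) * (v - u) + (e / 2) * (v - u)"
        using d2[of "v - u"] uv \<open>M > 0\<close> by (intro add_mono; simp add: \<omega>_def mult.assoc)
      finally show ?thesis by simp
    qed
    then show "\<exists>d>0. \<forall>u v. a \<le> u \<and> u < v \<and> v \<le> b \<and> v - u < d
                  \<longrightarrow> \<bar>G v - G u - \<phi> u * \<Xi> u v\<bar> \<le> e * (v - u)"
      using \<open>d1 > 0\<close> \<open>d2 > 0\<close> by (intro exI[of _ "min d1 d2"]; auto)
  qed
  then show ?thesis by (simp add: G_def)
qed

section \<open>Polynomial test functions\<close>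

lemma real_polynomial_function_antiderivative:
  assumes "real_polynomial_function q"
  obtains p where "real_polynomial_function p" "p a = 0"
    "\<And>x::real. (p has_real_derivative q x) (at x)"
proof -
  obtain c n where q: "q = (\<lambda>x. \<Sum>i\<le>n. c i * x ^ i)"
    using assms real_polynomial_function_iff_sum by blast
  define P where "P = (\<lambda>x::real. \<Sum>i\<le>n. c i / (real i + 1) * x ^ (i + 1))"
  have id: "real_polynomial_function (\<lambda>x::real. x)"
    by (intro real_polynomial_function.intros(1) bounded_linear_ident)
  have "real_polynomial_function P"
    unfolding P_def by (auto intro!: id real_polynomial_function.intros(2-) real_polynomial_function_sum real_polynomial_function_power)
  then have "real_polynomial_function (\<lambda>x. P x - P a)"
    by (auto intro!: real_polynomial_function.intros(2-) real_polynomial_function_diff)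
  moreover have "((\<lambda>x. P x - P a) has_real_derivative q x) (at x)" for x
  proof -
    have "(P has_real_derivative (\<Sum>i\<le>n. c i / (real i + 1) * (real (i + 1) * x ^ i))) (at x)"
      unfolding P_def
      using DERIV_pow[of "i + 1" x UNIV for i]
      by (intro DERIV_sum DERIV_cmult) simp
    moreover have "(\<Sum>i\<le>n. c i / (real i + 1) * (real (i + 1) * x ^ i)) = q x"
      unfolding q by (intro sum.cong refl) (simp add: field_simps add_nonneg_eq_0_iff)
    ultimately have "(P has_real_derivative q x) (at x)" by simp
    from DERIV_diff[OF this DERIV_const[of "P a"]] show ?thesis by simp
  qed
  ultimately show thesis using that[of "\<lambda>x. P x - P a"] by auto
qed

lemma path_deriv_eq:
  fixes f g :: "real \<Rightarrow> real"
  assumes "T > 0" "t \<in> {0..T}" and eq: "\<And>x. x \<in> {0..T} \<Longrightarrow> f x = g x"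
    and "(g has_real_derivative d) (at t)"
  shows "path_deriv T f t = d"
proof -
  have "(g has_vector_derivative d) (at t within {0..T})"
    using assms(4) by (simp add: has_real_derivative_iff_has_vector_derivative has_vector_derivative_at_within)
  then have "(f has_vector_derivative d) (at t within {0..T})"
    using has_vector_derivative_transform[OF assms(2)] eq by metis
  then show ?thesis
    using assms vector_derivative_within_cbox[of 0 T t f d] by (simp add: path_deriv_def)
qed

text \<open>The iterated one-sided derivatives of a polynomial agree on \<open>{0..T}\<close> with polynomials; outside the
interval they may be arbitrary, so the induction only speaks of values in \<open>{0..T}\<close>.\<close>

lemma real_polynomial_function_smooth:
  assumes "T > 0" "real_polynomial_function p"
  shows "p \<in> smooth_paths T"
proof -
  have "\<exists>q. real_polynomial_function q \<and> (\<forall>x\<in>{0..T}. (path_deriv T ^^ n) p x = q x)" for n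
  proof (induction n)
    case 0
    then show ?case using assms by auto
  next
    case (Suc n)
    then obtain q where q: "real_polynomial_function q" "\<And>x. x \<in> {0..T} \<Longrightarrow> (path_deriv T ^^ n) p x = q x"
      by blast
    obtain q' where q': "real_polynomial_function q'" "\<And>x. (q has_real_derivative q' x) (at x)"
      using has_real_derivative_polynomial_function[OF q(1)] by blast
    have "(path_deriv T ^^ Suc n) p x = q' x" if "x \<in> {0..T}" for x
      using path_deriv_eq[OF \<open>T > 0\<close> that q(2) q'(2)] by simp
    then show ?case using q'(1) by blast
  qed
  moreover have "f differentiable_on {0..T}"
    if "real_polynomial_function q" "\<And>x. x \<in> {0..T} \<Longrightarrow> f x = q x" for f q
  proof -
    obtain q' where "\<And>x. (q has_real_derivative q' x) (at x)"
      using has_real_derivative_polynomial_function[OF \<open>real_polynomial_function q\<close>] by blast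
    then have "q differentiable (at x within {0..T})" for x
      by (meson differentiable_at_withinI real_differentiable_def)
    then show ?thesis
      unfolding differentiable_on_def
      using that(2) by (metis differentiable_transform_within zero_less_one)
  qed
  ultimately show ?thesis unfolding smooth_paths_def by blast
qed

text \<open>Subtract the mean of \<open>g\<close>. Every polynomial of mean zero is the derivative of an admissible test function,
so the difference is orthogonal to all polynomials, hence by Weierstrass approximation to itself. Polynomials
thus do the work usually done by bump functions.\<close>

lemma du_Bois_Reymond_polynomial:
  fixes g :: "real \<Rightarrow> real"
  assumes "a < b" and g: "continuous_on {a..b} g"
    and orth: "\<And>p p'. \<lbrakk>real_polynomial_function p; real_polynomial_function p';
                 \<And>x. (p has_real_derivative p' x) (at x); p a = 0; p b = 0\<rbrakk>
               \<Longrightarrow> integral {a..b} (\<lambda>t. g t * p' t) = 0"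
  obtains c where "\<And>t. t \<in> {a..b} \<Longrightarrow> g t = c"
proof -
  define c where "c = integral {a..b} g / (b - a)"
  define h where "h = (\<lambda>t. g t - c)"
  have h: "continuous_on {a..b} h" unfolding h_def using g by (intro continuous_intros)
  have int: "f integrable_on {a..b}" if "continuous_on {a..b} f" for f :: "real \<Rightarrow> real"
    using that by (rule integrable_continuous_real)
  have polycont: "continuous_on {a..b} q" if "real_polynomial_function q" for q
    using continuous_on_polymonial_function[of q "{a..b}"] that by (simp add: real_polynomial_function_eq)
  have mean: "integral {a..b} h = 0"
    unfolding h_def using g int \<open>a < b\<close> by (subst integral_diff; auto simp: c_def)
  \<comment> \<open>\<open>q - m\<close> has mean zero, so its antiderivative vanishing at \<open>a\<close> also vanishes at \<open>b\<close> and is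
    admissible; the constant \<open>m\<close> is invisible to the mean-zero \<open>h\<close>.\<close>
  have h_orth: "integral {a..b} (\<lambda>t. h t * q t) = 0" if q: "real_polynomial_function q" for q
  proof -
    define m where "m = integral {a..b} q / (b - a)"
    have qm: "real_polynomial_function (\<lambda>t. q t - m)"
      by (intro q real_polynomial_function_diff real_polynomial_function.intros(2))
    have qc: "continuous_on {a..b} q" using polycont q .
    obtain p where p: "real_polynomial_function p" "p a = 0"
      "\<And>x. (p has_real_derivative q x - m) (at x)"
      by (rule real_polynomial_function_antiderivative[OF qm]) (rule that)
    have "((\<lambda>t. q t - m) has_integral p b - p a) {a..b}"
      using has_integral_real_derivative[of a b p, OF _ p(3)] \<open>a < b\<close> by simp
    then have "p b = integral {a..b} (\<lambda>t. q t - m)" using p(2) by (simp add: integral_unique)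
    also have "\<dots> = 0" using int[OF qc] \<open>a < b\<close> by (subst integral_diff; auto simp: m_def)
    finally have "p b = 0" .
    then have 1: "integral {a..b} (\<lambda>t. g t * (q t - m)) = 0"
      using orth[OF p(1) qm p(3,2)] by blast
    have 2: "integral {a..b} (\<lambda>t. c * (q t - m)) = 0"
      using \<open>integral {a..b} (\<lambda>t. q t - m) = 0\<close> by simp
    have 3: "integral {a..b} (\<lambda>t. m * h t) = 0" using mean by simp
    have gi: "(\<lambda>t. g t * (q t - m)) integrable_on {a..b}"
      by (intro int continuous_on_mult g polycont qm)
    have qi: "(\<lambda>t. c * (q t - m)) integrable_on {a..b}"
      by (intro int continuous_on_mult_left polycont qm)
    have hi: "(\<lambda>t. m * h t) integrable_on {a..b}"
      by (intro int continuous_on_mult_left h)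
    have "(\<lambda>t. h t * q t) = (\<lambda>t. (g t * (q t - m) - c * (q t - m)) + m * h t)"
      by (auto simp: h_def algebra_simps)
    then show ?thesis
      using 1 2 3
      by (simp only: integral_add[OF integrable_diff[OF gi qi] hi] integral_diff[OF gi qi])
  qed
  obtain B where B: "B > 0" "\<And>t. t \<in> {a..b} \<Longrightarrow> \<bar>h t\<bar> \<le> B"
    by (rule continuous_on_Icc_bounded[OF h]) (rule that)
  have "integral {a..b} (\<lambda>t. h t * h t) = 0"
  proof (rule ccontr)
    assume ne: "integral {a..b} (\<lambda>t. h t * h t) \<noteq> 0"
    define H where "H = \<bar>integral {a..b} (\<lambda>t. h t * h t)\<bar>"
    define d where "d = b - a"
    have "d > 0" using \<open>a < b\<close> by (simp add: d_def)
    define e where "e = H / (2 * B * d)"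
    have "e > 0" using ne B(1) \<open>d > 0\<close> by (simp add: e_def H_def)
    obtain q where q: "real_polynomial_function q" "\<And>x. x \<in> {a..b} \<Longrightarrow> \<bar>h x - q x\<bar> < e"
      by (rule Stone_Weierstrass_real_polynomial_function[OF compact_Icc h \<open>e > 0\<close>]) (rule that)
    have qc: "continuous_on {a..b} q" using polycont q(1) .
    have hd: "(\<lambda>t. h t * (h t - q t)) integrable_on {a..b}"
      by (intro int continuous_on_mult continuous_on_diff h qc)
    have hq: "(\<lambda>t. h t * q t) integrable_on {a..b}"
      by (intro int continuous_on_mult h qc)
    from integral_add[OF hd hq] have "integral {a..b} (\<lambda>t. h t * h t)
        = integral {a..b} (\<lambda>t. h t * (h t - q t))"
      by (simp add: h_orth[OF q(1)] algebra_simps)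
    then have "\<bar>integral {a..b} (\<lambda>t. h t * h t)\<bar> = norm (integral {a..b} (\<lambda>t. h t * (h t - q t)))"
      by simp
    also have "\<dots> \<le> (B * e) * (b - a)"
    proof (rule integral_bound)
      show "continuous_on {a..b} (\<lambda>t. h t * (h t - q t))" using h qc by (intro continuous_intros)
      show "norm (h t * (h t - q t)) \<le> B * e" if "t \<in> {a..b}" for t
        unfolding real_norm_def abs_mult
        using B(2)[OF that] q(2)[OF that] \<open>B > 0\<close> by (intro mult_mono; simp)
    qed (use \<open>a < b\<close> in simp)
    also have "\<dots> = H / 2"
      using B(1) \<open>d > 0\<close> unfolding e_def d_def[symmetric] by simp
    finally show False using ne by (simp add: H_def)
  qed
  then have "\<forall>t\<in>{a..b}. h t * h t = 0"
    using integral_cbox_eq_0_iff[of a b "\<lambda>t. h t * h t"] continuous_on_mult[OF h h] \<open>a < b\<close>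
    by simp
  then show thesis by (intro that[of c]) (simp add: h_def)
qed

section \<open>Identification of the path\<close>

theorem lemmaB4:
  fixes T \<alpha> :: real
    and Z :: "real \<Rightarrow> real^'k" and ZZ :: "real \<Rightarrow> real \<Rightarrow> real^'k^'k"
    and Y :: "real \<Rightarrow> real^'k" and Y' :: "real \<Rightarrow> real^'k^'k"
    and lam :: "real \<Rightarrow> real"
  assumes "T > 0" and "1/3 < \<alpha>" and "\<alpha> \<le> 1"
    and "(Z, ZZ) \<in> geometric_rough_paths T \<alpha>"
    and "(Y, Y') \<in> controlled_paths T \<alpha> Z"
    and "continuous_on {0..T} lam"
    and "\<And>\<phi>. \<phi> \<in> smooth_paths T \<Longrightarrow> \<phi> 0 = 0 \<Longrightarrow> \<phi> T = 0 \<Longrightarrow>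
           integral {0..T} (\<lambda>t. lam t * path_deriv T \<phi> t) =
           rough_integral (scale_controlled \<phi> (Y, Y')) (Z, ZZ) 0 T"
  shows "\<forall>s t. 0 \<le> s \<and> s \<le> t \<and> t \<le> T \<longrightarrow>
           lam t - lam s = - rough_integral (Y, Y') (Z, ZZ) s t"
proof -
  define \<Xi> where "\<Xi> = (\<lambda>u v. Y u \<bullet> incr Z u v + Y' u \<bullet> ZZ u v)"
  obtain \<gamma> C B where "\<gamma> > 1" "C \<ge> 0"
    and defect: "\<And>s u t. \<lbrakk>0 \<le> s; s < u; u < t; t \<le> T\<rbrakk> \<Longrightarrow> \<bar>\<Xi> s t - \<Xi> s u - \<Xi> u t\<bar> \<le> C * (t - s) powr \<gamma>"
    and small: "\<And>u v. \<lbrakk>0 \<le> u; u < v; v \<le> T\<rbrakk> \<Longrightarrow> \<bar>\<Xi> u v\<bar> \<le> B * (v - u) powr \<alpha>"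
  proof (cases "\<alpha> \<le> 1/2")
    case True
    have "0 < \<alpha>" "3 * \<alpha> > 1" using assms(2) by simp_all
    show thesis
      by (rule rough_germ_bounds[OF \<open>0 < \<alpha>\<close> True assms(4,5)]) (rule that[unfolded \<Xi>_def, OF \<open>3 * \<alpha> > 1\<close>])
  next
    case False
    then have "1/2 < \<alpha>" "2 * \<alpha> > 1" by simp_all
    show thesis
      by (rule Young_germ_bounds[OF \<open>1/2 < \<alpha>\<close> assms(4,5)]) (rule that[unfolded \<Xi>_def, OF \<open>2 * \<alpha> > 1\<close>])
  qed
  \<comment> \<open>\<open>J\<close> is the indefinite rough integral of \<open>Y\<close>.\<close>
  obtain K J where "K \<ge> 0"
    and J: "\<And>u v. \<lbrakk>0 \<le> u; u < v; v \<le> T\<rbrakk> \<Longrightarrow> \<bar>J v - J u - \<Xi> u v\<bar> \<le> K * (v - u) powr \<gamma>"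
    by (rule sewing[OF \<open>\<gamma> > 1\<close> \<open>C \<ge> 0\<close>, of 0 T \<Xi>]) (rule defect, assumption+, rule that)
  have cont: "continuous_on {0..T} J"
  proof (rule continuous_on_powr_modulus)
    show "\<bar>J v - J u\<bar> \<le> B * (v - u) powr \<alpha> + K * (v - u) powr \<gamma>" if "0 \<le> u" "u < v" "v \<le> T" for u v
      using small[OF that] J[OF that] by linarith
  qed (use assms(2) \<open>\<gamma> > 1\<close> in simp)+
  obtain c where c: "\<And>t. t \<in> {0..T} \<Longrightarrow> lam t + J t = c"
  proof (rule du_Bois_Reymond_polynomial[OF \<open>T > 0\<close>, of "\<lambda>t. lam t + J t"])
    show "continuous_on {0..T} (\<lambda>t. lam t + J t)" using assms(6) cont by (rule continuous_on_add)
  next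
    fix p p' :: "real \<Rightarrow> real"
    assume p: "real_polynomial_function p" "real_polynomial_function p'"
      and deriv: "\<And>x. (p has_real_derivative p' x) (at x)" and ends: "p 0 = 0" "p T = 0"
    have p': "continuous_on {0..T} p'"
      using continuous_on_polymonial_function[of p' "{0..T}"] p(2) by (simp add: real_polynomial_function_eq)
    have "integral {0..T} (\<lambda>t. lam t * p' t) = integral {0..T} (\<lambda>t. lam t * path_deriv T p t)"
      using path_deriv_eq[OF \<open>T > 0\<close> _ refl deriv] by (intro Henstock_Kurzweil_Integration.integral_cong) simp
    also have "\<dots> = rough_integral (scale_controlled p (Y, Y')) (Z, ZZ) 0 T"
      using assms(7) real_polynomial_function_smooth[OF \<open>T > 0\<close> p(1)] ends by blast
    also have "\<dots> = partition_integral (\<lambda>u v. p u * \<Xi> u v) 0 T"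
      by (simp add: scale_controlled_def rough_integral_germ \<Xi>_def distrib_left)
    also have "\<dots> = - integral {0..T} (\<lambda>t. J t * p' t)"
      using partition_integral_weighted_germ[OF _ \<open>\<gamma> > 1\<close> \<open>K \<ge> 0\<close> J cont deriv p'] ends \<open>T > 0\<close> by simp
    finally have "integral {0..T} (\<lambda>t. lam t * p' t) + integral {0..T} (\<lambda>t. J t * p' t) = 0" by simp
    then show "integral {0..T} (\<lambda>t. (lam t + J t) * p' t) = 0"
      unfolding distrib_right using assms(6) cont p'
      by (subst integral_add; auto intro!: integrable_continuous_real continuous_intros)
  qed (rule that)
  show ?thesis
  proof (intro allI impI)
    fix s t assume st: "0 \<le> s \<and> s \<le> t \<and> t \<le> T"
    have "rough_integral (Y, Y') (Z, ZZ) s t = J t - J s"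
      unfolding rough_integral_germ \<Xi>_def[symmetric]
    proof (rule partition_integral_eqI_powr[OF _ \<open>\<gamma> > 1\<close> \<open>K \<ge> 0\<close>])
      show "\<bar>J v - J u - \<Xi> u v\<bar> \<le> K * (v - u) powr \<gamma>" if "s \<le> u" "u < v" "v \<le> t" for u v
        using J[of u v] that st by simp
    qed (use st in simp)
    then show "lam t - lam s = - rough_integral (Y, Y') (Z, ZZ) s t"
      using c[of s] c[of t] st by simp
  qed
qed

end
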